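(* Let $p$ be a polynomial on $M(X)$ of degree $n$. Then $$p(\omega)=\sum_{k=0}^n\langle(\omega)_k,g^{(k)}\rangle\quad\text{for all }\omega\in M(X),$$ where $g^{(0)}=p(0)$ and, for $k=1,\dots,n$ and $x_1,\dots,x_k\in X$, $$g^{(k)}(x_1,\dots,x_k)=\frac1{k!}(D_{x_1}\cdots D_{x_k}p)(0)=\frac{(-1)^k}{k!}\sum_{I\subseteq\{1,\dots,k\}}(-1)^{|I|}\,p\Big(\sum_{i\in I}\delta_{x_i}\Big).$$ In particular, for each $n\in\mathbb N$, $k=1,\dots,n$, $f\in\mathcal F^{(n)}(X)$ and $x_1,\dots,x_k\in X$, $$(\mathbf S(n,k)f)(x_1,\dots,x_k)=\frac{(-1)^k}{k!}\sum_{I\subseteq\{1,\dots,k\}}(-1)^{|I|}\Big\langle\Big(\sum_{i\in I}\delta_{x_i}\Big)^{\otimes n},f\Big\rangle.$$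
   Context: Let $X$ be a locally compact Polish space, $\mathbb F\in\{\mathbb R,\mathbb C\}$, $M(X)$ the set of $\mathbb F$-valued Radon measures on $X$. For $n\ge1$, $\mathcal F^{(n)}(X)$ is the space of bounded measurable symmetric compactly supported functions $X^n\to\mathbb F$, $\mathcal F^{(0)}(X):=\mathbb F$. $\langle\mu,f\rangle:=\int f\,d\mu$; $\omega^{\otimes 0}:=1$, $(\omega)_0:=1$, $\langle c,a\rangle:=ca$ for $c,a\in\mathbb F$. A polynomial on $M(X)$ is a function $p(\omega)=\sum_{k=0}^n\langle\omega^{\otimes k},f^{(k)}\rangle$ with $f^{(k)}\in\mathcal F^{(k)}(X)$; it has degree $n$ if $f^{(n)}\ne0$. For $x\in X$, $(D_xp)(\omega):=p(\omega+\delta_x)-p(\omega)$. For $\omega\in M(X)$ and $n\ge1$, $(\omega)_n$ is the Radon measure on $X^n$, $(\omega)_n(dx_1\cdots dx_n)=\omega(dx_1)(\omega(dx_2)-\delta_{x_1}(dx_2))\cdots(\omega(dx_n)-\delta_{x_1}(dx_n)-\dots-\delta_{x_{n-1}}(dx_n))$. For $1\le k\le n$, $\mathbf S(n,k):\mathcal F^{(n)}(X)\to\mathcal F^{(k)}(X)$ are the linear operators uniquely determined by $\langle\omega^{\otimes n},f\rangle=\sum_{k=1}^n\langle(\omega)_k,\mathbf S(n,k)f\rangle$ for all $\omega\in M(X)$, $f\in\mathcal F^{(n)}(X)$. An empty sum of Dirac measures is the zero measure. *)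

theory Defs
  imports "HOL-Analysis.Analysis"
begin

text \<open>
  The scalar field is a type of sort \<open>{real_normed_field, euclidean_space}\<close>. Its instances
  include \<open>real\<close> (with \<open>Basis = {1}\<close>) and \<open>complex\<close> (with \<open>Basis = {1, \<i>}\<close>); by the Frobenius
  theorem every instance is isomorphic to one of these two fields.
\<close>

section \<open>Scalar-valued Radon measures\<close>

definition borel_of :: "'b topology \<Rightarrow> 'b measure" where
  "borel_of T = sigma (topspace T) {U. openin T U}"

definition precompact_sets :: "'b topology \<Rightarrow> 'b set set" where
  "precompact_sets T = {A \<in> sets (borel_of T). compactin T (T closure_of A)}"

text \<open>
  On the locally compact Polish spaces considered here, a Borel measure that is finite on
  compact sets is automatically regular, so regularity is not listed.
\<close>

definition nonneg_radon :: "'b topology \<Rightarrow> 'b measure \<Rightarrow> bool" where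
  "nonneg_radon T \<mu> \<longleftrightarrow>
     sets \<mu> = sets (borel_of T) \<and> (\<forall>K. compactin T K \<longrightarrow> emeasure \<mu> K < \<infinity>)"

text \<open>
  Each real component of a scalar-valued Radon measure (the real and the imaginary part, in the
  complex case) is a difference of two nonnegative Radon measures. The components may both have
  infinite mass, so the difference makes sense only on precompact Borel sets; a scalar-valued
  Radon measure is therefore a function of such sets. It is given the value 0 on all other sets,
  so that two measures are equal iff they agree on the precompact Borel sets.
\<close>

definition radon_decomposition ::
    "'b topology \<Rightarrow> ('b set \<Rightarrow> 'f::{real_normed_field,euclidean_space}) \<Rightarrow>
     ('f \<Rightarrow> 'b measure) \<Rightarrow> ('f \<Rightarrow> 'b measure) \<Rightarrow> bool" where
  "radon_decomposition T \<omega> P N \<longleftrightarrow>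
     (\<forall>b\<in>Basis. nonneg_radon T (P b) \<and> nonneg_radon T (N b)) \<and>
     (\<forall>A. \<omega> A = (if A \<in> precompact_sets T
                 then \<Sum>b\<in>Basis. (measure (P b) A - measure (N b) A) *\<^sub>R b else 0))"

definition radon_measures ::
    "'b topology \<Rightarrow> ('b set \<Rightarrow> 'f::{real_normed_field,euclidean_space}) set" where
  "radon_measures T = {\<omega>. \<exists>P N. radon_decomposition T \<omega> P N}"

text \<open>
  For bounded measurable compactly supported \<open>f\<close> the value does not depend on the decomposition.
\<close>

definition radon_integral ::
    "'b topology \<Rightarrow> ('b set \<Rightarrow> 'f::{real_normed_field,euclidean_space}) \<Rightarrow> ('b \<Rightarrow> 'f) \<Rightarrow> 'f" where
  "radon_integral T \<omega> f =
     (THE I. \<exists>P N. radon_decomposition T \<omega> P N \<and>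
        I = (\<Sum>b\<in>Basis. b * (integral\<^sup>L (P b) f - integral\<^sup>L (N b) f)))"

definition dirac :: "'b topology \<Rightarrow> 'b \<Rightarrow> 'b set \<Rightarrow> 'f::{real_normed_field,euclidean_space}" where
  "dirac T x A = (if A \<in> precompact_sets T \<and> x \<in> A then 1 else 0)"


section \<open>Powers of the space\<close>

text \<open>
  A point of \<open>X\<^sup>n\<close> is an extensional function \<open>x\<close> on \<open>{..<n}\<close>; the coordinates are \<open>x 0, \<dots>, x (n - 1)\<close>.
  In particular \<open>X\<^sup>0\<close> consists of the single point \<open>\<lambda>_. undefined\<close>.
\<close>

definition power_top :: "nat \<Rightarrow> (nat \<Rightarrow> 'a::topological_space) topology" where
  "power_top n = product_topology (\<lambda>_. euclidean) {..<n}"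

text \<open>
  Functions on \<open>X\<^sup>n\<close> are extended by 0 outside \<open>X\<^sup>n\<close>, so that equality of functions and the
  vector space operations are the pointwise ones. Since \<open>X\<^sup>0\<close> is a point, evaluation at that
  point identifies \<open>test_functions 0\<close> with the scalar field.
\<close>

definition test_functions ::
    "nat \<Rightarrow> ((nat \<Rightarrow> 'a::topological_space) \<Rightarrow> 'f::{real_normed_field,euclidean_space}) set" where
  "test_functions n = {f.
     f \<in> borel_measurable (borel_of (power_top n)) \<and>
     (\<exists>B. \<forall>x\<in>topspace (power_top n). norm (f x) \<le> B) \<and>
     (\<forall>\<pi>. \<pi> permutes {..<n} \<longrightarrow> (\<forall>x\<in>topspace (power_top n). f (x \<circ> \<pi>) = f x)) \<and>
     compactin (power_top n) (power_top n closure_of {x \<in> topspace (power_top n). f x \<noteq> 0}) \<and>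
     (\<forall>x. x \<notin> topspace (power_top n) \<longrightarrow> f x = 0)}"

definition pairing ::
    "nat \<Rightarrow> ((nat \<Rightarrow> 'a::topological_space) set \<Rightarrow> 'f::{real_normed_field,euclidean_space}) \<Rightarrow>
     ((nat \<Rightarrow> 'a) \<Rightarrow> 'f) \<Rightarrow> 'f" where
  "pairing n \<nu> f = radon_integral (power_top n) \<nu> f"

text \<open>The measure \<open>\<nu>(dx\<^sub>1 \<cdots> dx\<^sub>n) \<kappa>(x\<^sub>1, \<dots>, x\<^sub>n; dx\<^sub>n\<^sub>+\<^sub>1)\<close> on \<open>X\<^sup>n\<^sup>+\<^sup>1\<close>.\<close>

definition kernel_product ::
    "nat \<Rightarrow> ((nat \<Rightarrow> 'a::topological_space) set \<Rightarrow> 'f::{real_normed_field,euclidean_space}) \<Rightarrow>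
     ((nat \<Rightarrow> 'a) \<Rightarrow> 'a set \<Rightarrow> 'f) \<Rightarrow> (nat \<Rightarrow> 'a) set \<Rightarrow> 'f" where
  "kernel_product n \<nu> \<kappa> A =
     (if A \<in> precompact_sets (power_top (Suc n))
      then radon_integral (power_top n) \<nu>
             (\<lambda>x. if x \<in> topspace (power_top n) then \<kappa> x {y. x(n := y) \<in> A} else 0)
      else 0)"

text \<open>
  \<open>tensor_power \<omega> n\<close> is the product measure and \<open>falling_power \<omega> n\<close> is
  \<open>\<omega>(dx\<^sub>1) (\<omega> - \<delta>\<^bsub>x\<^sub>1\<^esub>)(dx\<^sub>2) \<cdots> (\<omega> - \<delta>\<^bsub>x\<^sub>1\<^esub> - \<dots> - \<delta>\<^bsub>x\<^sub>n\<^sub>-\<^sub>1\<^esub>)(dx\<^sub>n)\<close>. For \<open>n = 0\<close> both are the unit mass on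
  the one-point space \<open>X\<^sup>0\<close>, so that pairing with a scalar (see above) returns that scalar.
\<close>

primrec tensor_power ::
    "('a::topological_space set \<Rightarrow> 'f::{real_normed_field,euclidean_space}) \<Rightarrow> nat \<Rightarrow>
     (nat \<Rightarrow> 'a) set \<Rightarrow> 'f" where
  "tensor_power \<omega> 0 = dirac (power_top 0) (\<lambda>_. undefined)"
| "tensor_power \<omega> (Suc n) = kernel_product n (tensor_power \<omega> n) (\<lambda>_. \<omega>)"

primrec falling_power ::
    "('a::topological_space set \<Rightarrow> 'f::{real_normed_field,euclidean_space}) \<Rightarrow> nat \<Rightarrow>
     (nat \<Rightarrow> 'a) set \<Rightarrow> 'f" where
  "falling_power \<omega> 0 = dirac (power_top 0) (\<lambda>_. undefined)"
| "falling_power \<omega> (Suc n) =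
     kernel_product n (falling_power \<omega> n) (\<lambda>x A. \<omega> A - (\<Sum>i<n. dirac euclidean (x i) A))"


section \<open>Polynomials, difference operators and Stirling operators\<close>

definition zero_measure :: "'a set \<Rightarrow> 'f::{real_normed_field,euclidean_space}" where
  "zero_measure = (\<lambda>_. 0)"

definition sum_dirac ::
    "(nat \<Rightarrow> 'a::topological_space) \<Rightarrow> nat set \<Rightarrow> 'a set \<Rightarrow> 'f::{real_normed_field,euclidean_space}" where
  "sum_dirac x I = (\<lambda>A. \<Sum>i\<in>I. dirac euclidean (x i) A)"

text \<open>Only the values of \<open>p\<close> on \<open>radon_measures euclidean\<close> matter.\<close>

definition polynomial_of_degree ::
    "nat \<Rightarrow> (('a::topological_space set \<Rightarrow> 'f::{real_normed_field,euclidean_space}) \<Rightarrow> 'f) \<Rightarrow> bool" where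
  "polynomial_of_degree n p \<longleftrightarrow>
     (\<exists>f. (\<forall>k\<le>n. f k \<in> test_functions k) \<and> f n \<noteq> (\<lambda>_. 0) \<and>
          (\<forall>\<omega>\<in>radon_measures euclidean. p \<omega> = (\<Sum>k\<le>n. pairing k (tensor_power \<omega> k) (f k))))"

definition diff_op ::
    "'a::topological_space \<Rightarrow> (('a set \<Rightarrow> 'f::{real_normed_field,euclidean_space}) \<Rightarrow> 'f) \<Rightarrow>
     ('a set \<Rightarrow> 'f) \<Rightarrow> 'f" where
  "diff_op x p = (\<lambda>\<omega>. p (\<lambda>A. \<omega> A + dirac euclidean x A) - p \<omega>)"

definition linear_on_test_functions ::
    "nat \<Rightarrow> nat \<Rightarrow> (((nat \<Rightarrow> 'a::topological_space) \<Rightarrow> 'f::{real_normed_field,euclidean_space}) \<Rightarrow>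
     (nat \<Rightarrow> 'a) \<Rightarrow> 'f) \<Rightarrow> bool" where
  "linear_on_test_functions n k S \<longleftrightarrow>
     (\<forall>f\<in>test_functions n. S f \<in> test_functions k) \<and>
     (\<forall>f\<in>test_functions n. \<forall>g\<in>test_functions n. S (\<lambda>x. f x + g x) = (\<lambda>x. S f x + S g x)) \<and>
     (\<forall>c. \<forall>f\<in>test_functions n. S (\<lambda>x. c * f x) = (\<lambda>x. c * S f x))"

definition stirling_family ::
    "nat \<Rightarrow> (nat \<Rightarrow> ((nat \<Rightarrow> 'a::topological_space) \<Rightarrow> 'f::{real_normed_field,euclidean_space}) \<Rightarrow>
     (nat \<Rightarrow> 'a) \<Rightarrow> 'f) \<Rightarrow> bool" where
  "stirling_family n S \<longleftrightarrow>
     (\<forall>k\<in>{1..n}. linear_on_test_functions n k (S k)) \<and>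
     (\<forall>\<omega>\<in>radon_measures euclidean. \<forall>f\<in>test_functions n.
        pairing n (tensor_power \<omega> n) f = (\<Sum>k=1..n. pairing k (falling_power \<omega> k) (S k f)))"

text \<open>
  Stated pointwise in \<open>f\<close>, because the defining property determines \<open>S k f\<close> only for
  \<open>k \<in> {1..n}\<close> and \<open>f \<in> test_functions n\<close>.
\<close>

definition stirling_op ::
    "nat \<Rightarrow> nat \<Rightarrow> ((nat \<Rightarrow> 'a::topological_space) \<Rightarrow> 'f::{real_normed_field,euclidean_space}) \<Rightarrow>
     (nat \<Rightarrow> 'a) \<Rightarrow> 'f" where
  "stirling_op n k f = (THE g. \<exists>S. stirling_family n S \<and> S k f = g)"

end

theory Submission
  imports Defs "HOL-Probability.Giry_Monad"
begin

text \<open>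
  For arbitrary bounded compactly supported \<open>f\<close>, writing \<open>\<omega>(dy) = (\<omega> - \<Sum>\<^sub>i \<delta>\<^sub>x\<^sub>i)(dy) + \<Sum>\<^sub>i \<delta>\<^sub>x\<^sub>i(dy)\<close> in the
  last factor of \<open>\<omega>\<^bsup>\<otimes>n\<^esup>\<close> and iterating expands \<open>\<langle>\<omega>\<^bsup>\<otimes>n\<^esup>, f\<rangle>\<close> as a sum over the set partitions of
  \<open>{1, \<dots>, n}\<close> of pairings \<open>\<langle>(\<omega>)\<^sub>k, \<cdot>\<rangle>\<close> with restrictions of \<open>f\<close> to diagonals. Since \<open>(\<omega>)\<^sub>k\<close> is symmetric
  by Fubini, these restrictions may be symmetrized, which produces the Stirling operators. At a
  finite sum of Dirac measures \<open>\<langle>(\<omega>)\<^sub>k, g\<rangle>\<close> is a sum of \<open>g\<close> over injective choices of the atoms, so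
  Moebius inversion over the subsets of the atoms recovers \<open>g\<close>; this gives both the formula and the
  uniqueness of the operators.
\<close>

section \<open>Integration against scalar-valued Radon measures\<close>

text \<open>Much of the work goes into the measures themselves. Even for nonnegative \<omega> the
  kernel that subtracts Dirac measures need not be nonnegative, and products of elements of
  \<open>Basis\<close> need not lie in \<open>Basis\<close>, so no preferred decomposition survives
  the recursion. Measures are therefore treated as finite field-linear combinations of nonnegative
  ones (\<open>represents\<close>), with an integral independent of the combination. A kernel
  product then splits into ordinary product measures and images under
  \<open>x \<mapsto> x(n := x i)\<close>, and Fubini is only invoked for nonnegative measures, which
  local compactness makes sigma-finite. The inversion takes one atom for each coordinate of x. Terms
  of order m other than k drop out because {..<m} is mapped bijectively onto a set of k indices only
  if m = k. The factor 1 / k! counts the remaining injections, which all give the same value because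
  \<open>g k\<close> is symmetric; for a function without symmetry the inversion would return its
  symmetrization, which is why uniqueness concerns symmetric functions.\<close>

lemma space_borel_of [simp]: "space (borel_of T) = topspace T"
  unfolding borel_of_def by (rule space_measure_of) (auto dest: openin_subset)

lemma sets_borel_of: "sets (borel_of T) = sigma_sets (topspace T) {U. openin T U}"
  unfolding borel_of_def by (rule sets_measure_of) (auto dest: openin_subset)

lemma closedin_in_borel_of:
  assumes "closedin T C"
  shows "C \<in> sets (borel_of T)"
proof -
  have "topspace T - C \<in> sets (borel_of T)"
    using assms unfolding sets_borel_of by (auto intro!: sigma_sets.Basic)
  then have "space (borel_of T) - (topspace T - C) \<in> sets (borel_of T)"
    by (rule sets.compl_sets)
  moreover have "space (borel_of T) - (topspace T - C) = C"
    using closedin_subset[OF assms] by auto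
  ultimately show ?thesis by simp
qed

lemma compactin_in_borel_of:
  "Hausdorff_space T \<Longrightarrow> compactin T K \<Longrightarrow> K \<in> sets (borel_of T)"
  by (intro closedin_in_borel_of compactin_imp_closedin)

lemma precompact_setsI:
  assumes "Hausdorff_space T" "compactin T K" "A \<in> sets (borel_of T)" "A \<subseteq> K"
  shows "A \<in> precompact_sets T"
proof -
  have "T closure_of A \<subseteq> K"
    using assms by (intro closure_of_minimal compactin_imp_closedin)
  then have "compactin T (T closure_of A)"
    using assms closed_compactin closedin_closure_of by blast
  then show ?thesis
    using assms by (auto simp: precompact_sets_def)
qed

lemma precompact_setsD:
  assumes "A \<in> precompact_sets T"
  shows "A \<in> sets (borel_of T)" "\<exists>K. compactin T K \<and> A \<subseteq> K"
proof -
  show A: "A \<in> sets (borel_of T)"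
    using assms by (auto simp: precompact_sets_def)
  have "A \<subseteq> T closure_of A"
    using sets.sets_into_space[OF A] by (simp add: closure_of_subset)
  then show "\<exists>K. compactin T K \<and> A \<subseteq> K"
    using assms by (auto simp: precompact_sets_def)
qed

text \<open>Symmetry is left out because restriction to a diagonal destroys it. A compact set off
  which f vanishes is easier to carry through sums and restrictions than the closure of the
  support.\<close>

definition bounded_cs :: "'b topology \<Rightarrow> ('b \<Rightarrow> 'f::{real_normed_field,euclidean_space}) \<Rightarrow> bool" where
  "bounded_cs T f \<longleftrightarrow> f \<in> borel_measurable (borel_of T) \<and> (\<exists>B. \<forall>x. norm (f x) \<le> B) \<and>
     (\<exists>K. compactin T K \<and> (\<forall>x. x \<notin> K \<longrightarrow> f x = 0))"

lemma bounded_cs_zero: "bounded_cs T (\<lambda>_. 0)"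
  unfolding bounded_cs_def by (auto intro!: exI[of _ 0] exI[of _ "{}"])

lemma bounded_cs_add:
  assumes "bounded_cs T f" "bounded_cs T g"
  shows "bounded_cs T (\<lambda>x. f x + g x)"
proof -
  obtain B C K L where *: "\<forall>x. norm (f x) \<le> B" "\<forall>x. norm (g x) \<le> C"
      "compactin T K" "\<forall>x. x \<notin> K \<longrightarrow> f x = 0" "compactin T L" "\<forall>x. x \<notin> L \<longrightarrow> g x = 0"
    using assms unfolding bounded_cs_def by metis
  have "norm (f x + g x) \<le> B + C" for x
    using * by (meson add_mono norm_triangle_le)
  moreover have "compactin T (K \<union> L)"
    using * by (simp add: compactin_Un)
  moreover have "\<forall>x. x \<notin> K \<union> L \<longrightarrow> f x + g x = 0"
    using * by simp
  ultimately show ?thesis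
    using assms unfolding bounded_cs_def by (intro conjI borel_measurable_add) blast+
qed

lemma bounded_cs_mult_left:
  assumes "bounded_cs T f"
  shows "bounded_cs T (\<lambda>x. c * f x)"
proof -
  obtain B K where *: "\<forall>x. norm (f x) \<le> B" "compactin T K" "\<forall>x. x \<notin> K \<longrightarrow> f x = 0"
    using assms unfolding bounded_cs_def by metis
  have "norm (c * f x) \<le> norm c * B" for x
    using * by (simp add: mult_left_mono norm_mult)
  moreover have "\<forall>x. x \<notin> K \<longrightarrow> c * f x = 0"
    using * by simp
  ultimately show ?thesis
    using assms *(2) unfolding bounded_cs_def
    by (intro conjI borel_measurable_times borel_measurable_const) blast+
qed

lemma bounded_cs_diff:
  "bounded_cs T f \<Longrightarrow> bounded_cs T g \<Longrightarrow> bounded_cs T (\<lambda>x. f x - g x)"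
  using bounded_cs_add[of T f "\<lambda>x. (-1) * g x"] bounded_cs_mult_left[of T g "-1"] by simp

lemma bounded_cs_sum:
  "(\<And>i. i \<in> I \<Longrightarrow> bounded_cs T (f i)) \<Longrightarrow> bounded_cs T (\<lambda>x. \<Sum>i\<in>I. f i x)"
  by (induction I rule: infinite_finite_induct) (auto intro: bounded_cs_zero bounded_cs_add)

lemma bounded_cs_indicator:
  assumes "A \<in> precompact_sets T"
  shows "bounded_cs T (indicator A)"
proof -
  obtain K where "compactin T K" "A \<subseteq> K"
    using precompact_setsD[OF assms] by blast
  moreover have "norm (indicator A x :: 'b) \<le> 1" for x
    by (simp add: indicator_def)
  ultimately show ?thesis
    using precompact_setsD(1)[OF assms] unfolding bounded_cs_def
    by (auto simp: indicator_def intro!: exI[of _ 1] exI[of _ K])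
qed

section \<open>Nonnegative Radon measures\<close>

lemma nonneg_radon_precompact:
  assumes "nonneg_radon T \<mu>" "Hausdorff_space T" "A \<in> precompact_sets T"
  shows "A \<in> sets \<mu>" "emeasure \<mu> A < \<infinity>"
proof -
  obtain K where K: "compactin T K" "A \<subseteq> K"
    using precompact_setsD[OF assms(3)] by blast
  show "A \<in> sets \<mu>"
    using precompact_setsD[OF assms(3)] assms by (auto simp: nonneg_radon_def)
  have "K \<in> sets \<mu>"
    using compactin_in_borel_of[OF assms(2) K(1)] assms by (auto simp: nonneg_radon_def)
  then have "emeasure \<mu> A \<le> emeasure \<mu> K"
    by (rule emeasure_mono[OF K(2)])
  also have "\<dots> < \<infinity>"
    using assms K by (auto simp: nonneg_radon_def)
  finally show "emeasure \<mu> A < \<infinity>" .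
qed

lemma nonneg_radon_measurable:
  "nonneg_radon T \<mu> \<Longrightarrow> bounded_cs T f \<Longrightarrow> f \<in> borel_measurable \<mu>"
  unfolding nonneg_radon_def bounded_cs_def using measurable_cong_sets by blast

lemma nonneg_radon_space: "nonneg_radon T \<mu> \<Longrightarrow> space \<mu> = topspace T"
  unfolding nonneg_radon_def by (metis sets_eq_imp_space_eq space_borel_of)

lemma nonneg_radon_integrable_indicator:
  assumes "nonneg_radon T \<mu>" "Hausdorff_space T" "compactin T K"
  shows "integrable \<mu> (\<lambda>x. B * indicator K x :: real)"
proof -
  have "K \<in> sets \<mu>" "emeasure \<mu> K < \<infinity>"
    using assms compactin_in_borel_of[OF assms(2,3)] by (auto simp: nonneg_radon_def)
  then show ?thesis
    by (intro integrable_mult_right integrable_real_indicator)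
qed

lemma nonneg_radon_integrable:
  assumes "nonneg_radon T \<mu>" "Hausdorff_space T" "bounded_cs T f"
  shows "integrable \<mu> f"
proof -
  obtain B K where *: "\<forall>x. norm (f x) \<le> B" "compactin T K" "\<forall>x. x \<notin> K \<longrightarrow> f x = 0"
    using assms unfolding bounded_cs_def by metis
  have B: "B \<ge> 0"
    using *(1) norm_ge_zero order_trans by blast
  show ?thesis
  proof (rule Bochner_Integration.integrable_bound)
    show "integrable \<mu> (\<lambda>x. B * indicator K x :: real)"
      using assms * by (intro nonneg_radon_integrable_indicator)
    show "AE x in \<mu>. norm (f x) \<le> norm (B * indicator K x :: real)"
      using * B by (auto simp: indicator_def)
  qed (use assms nonneg_radon_measurable in auto)
qed

text \<open>Since the Radon measures may be infinite, they are compared on precompact sets only, and the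
  approximating simple functions must be supported there.\<close>

lemma signed_combination_integral_zero:
  fixes c :: "'i \<Rightarrow> 'f::{real_normed_field,euclidean_space}"
  assumes T: "Hausdorff_space T" and M: "\<And>j. j \<in> J \<Longrightarrow> nonneg_radon T (M j)"
    and zero: "\<And>A. A \<in> precompact_sets T \<Longrightarrow> (\<Sum>j\<in>J. measure (M j) A *\<^sub>R c j) = 0"
    and f: "bounded_cs T f"
  shows "(\<Sum>j\<in>J. c j * integral\<^sup>L (M j) f) = 0"
proof -
  obtain B K where *: "\<forall>x. norm (f x) \<le> B" "compactin T K" "\<forall>x. x \<notin> K \<longrightarrow> f x = 0"
    using f unfolding bounded_cs_def by metis
  have fm: "f \<in> borel_measurable (borel_of T)"
    using f unfolding bounded_cs_def by blast
  obtain F where F: "\<And>i. simple_function (borel_of T) (F i)"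
      "\<And>x. x \<in> topspace T \<Longrightarrow> (\<lambda>i. F i x) \<longlonglongrightarrow> f x"
      "\<And>i x. x \<in> topspace T \<Longrightarrow> norm (F i x) \<le> 2 * norm (f x)"
    using borel_measurable_implies_sequence_metric[OF fm, of 0] unfolding dist_0_norm space_borel_of dist_norm diff_zero by metis
  have Fb: "norm (F i x) \<le> 2 * B * indicator K x" if "x \<in> topspace T" for i x
    using F(3)[OF that, of i] *(1,3) that by (cases "x \<in> K") (auto simp: indicator_def intro: order_trans)
  have "(\<Sum>j\<in>J. c j * integral\<^sup>L (M j) (F i)) = 0" for i
  proof -
    \<comment> \<open>The value 0 is dropped because its level set need not be precompact. The other
      level sets lie in K, since \<open>F i\<close> is dominated by a multiple of the norm of
      f.\<close>
    define Y where "Y = F i ` topspace T - {0}"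
    define A where "A y = F i -` {y} \<inter> topspace T" for y
    have finY: "finite Y"
      using simple_functionD(1)[OF F(1)[of i]] by (simp add: Y_def)
    have A: "A y \<in> precompact_sets T" if "y \<in> Y" for y
    proof (rule precompact_setsI[OF T *(2)])
      show "A y \<in> sets (borel_of T)"
        using simple_functionD(2)[OF F(1)[of i], of "{y}"] by (simp add: A_def)
      show "A y \<subseteq> K"
      proof
        fix x assume x: "x \<in> A y"
        then have "F i x \<noteq> 0" "x \<in> topspace T" using that by (auto simp: A_def Y_def)
        then show "x \<in> K" using F(3)[of x i] *(3) by force
      qed
    qed
    have Fx: "F i x = (\<Sum>y\<in>Y. indicator (A y) x *\<^sub>R y)" if "x \<in> topspace T" for x
    proof -
      have "F i x = (\<Sum>y\<in>F i ` topspace T. indicator (A y) x *\<^sub>R y)"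
        using simple_function_indicator_representation_banach[OF F(1)[of i], of x] that
        unfolding A_def space_borel_of by blast
      also have "\<dots> = (\<Sum>y\<in>Y. indicator (A y) x *\<^sub>R y)"
        using simple_functionD(1)[OF F(1)[of i]] by (intro sum.mono_neutral_right) (auto simp: Y_def)
      finally show ?thesis .
    qed
    have "integral\<^sup>L (M j) (F i) = (\<Sum>y\<in>Y. measure (M j) (A y) *\<^sub>R y)" if j: "j \<in> J" for j
    proof -
      have "integral\<^sup>L (M j) (F i) = (\<integral>x. (\<Sum>y\<in>Y. indicator (A y) x *\<^sub>R y) \<partial>M j)"
        by (intro Bochner_Integration.integral_cong) (auto simp: Fx nonneg_radon_space[OF M[OF j]])
      also have "\<dots> = (\<Sum>y\<in>Y. \<integral>x. indicator (A y) x *\<^sub>R y \<partial>M j)"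
        by (intro Bochner_Integration.integral_sum integrable_scaleR_left integrable_real_indicator
              nonneg_radon_precompact[OF M[OF j] T A])
      also have "\<dots> = (\<Sum>y\<in>Y. measure (M j) (A y) *\<^sub>R y)"
      proof (rule sum.cong[OF refl])
        fix y assume "y \<in> Y"
        then have y: "A y \<in> sets (M j)" "emeasure (M j) (A y) < \<infinity>"
          using nonneg_radon_precompact[OF M[OF j] T A] by auto
        then have "(\<integral>x. indicator (A y) x *\<^sub>R y \<partial>M j) = (\<integral>x. indicator (A y) x \<partial>M j) *\<^sub>R y"
          by (intro integral_scaleR_left) auto
        also have "(\<integral>x. indicator (A y) x \<partial>M j) = measure (M j) (A y)"
          using y by simp
        finally show "(\<integral>x. indicator (A y) x *\<^sub>R y \<partial>M j) = measure (M j) (A y) *\<^sub>R y" .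
      qed
      finally show ?thesis .
    qed
    then have "(\<Sum>j\<in>J. c j * integral\<^sup>L (M j) (F i)) = (\<Sum>j\<in>J. \<Sum>y\<in>Y. (measure (M j) (A y) *\<^sub>R c j) * y)"
      by (simp add: sum_distrib_left)
    also have "\<dots> = (\<Sum>y\<in>Y. (\<Sum>j\<in>J. measure (M j) (A y) *\<^sub>R c j) * y)"
      by (subst sum.swap) (simp add: sum_distrib_right)
    also have "\<dots> = 0"
      by (intro sum.neutral ballI) (simp add: zero A)
    finally show ?thesis .
  qed
  moreover have "(\<lambda>i. \<Sum>j\<in>J. c j * integral\<^sup>L (M j) (F i)) \<longlonglongrightarrow> (\<Sum>j\<in>J. c j * integral\<^sup>L (M j) f)"
  proof (intro tendsto_sum tendsto_mult tendsto_const)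
    fix j assume j: "j \<in> J"
    have sp: "space (M j) = topspace T" and se: "sets (M j) = sets (borel_of T)"
      using nonneg_radon_space[OF M[OF j]] M[OF j] by (auto simp: nonneg_radon_def)
    show "(\<lambda>i. integral\<^sup>L (M j) (F i)) \<longlonglongrightarrow> integral\<^sup>L (M j) f"
    proof (rule integral_dominated_convergence)
      show "integrable (M j) (\<lambda>x. 2 * B * indicator K x :: real)"
        by (intro nonneg_radon_integrable_indicator[OF M[OF j] T *(2)])
      show "f \<in> borel_measurable (M j)"
        using fm se measurable_cong_sets by blast
      show "F i \<in> borel_measurable (M j)" for i
        using borel_measurable_simple_function[OF F(1)] se measurable_cong_sets by blast
      show "AE x in M j. (\<lambda>i. F i x) \<longlonglongrightarrow> f x"
        using F(2) sp by (intro AE_I2) auto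
      show "AE x in M j. norm (F i x) \<le> 2 * B * indicator K x" for i
        using Fb sp by (intro AE_I2) auto
    qed
  qed
  ultimately show ?thesis
    by (simp add: LIMSEQ_const_iff)
qed

definition represents ::
    "'b topology \<Rightarrow> 'i set \<Rightarrow> ('i \<Rightarrow> 'f::{real_normed_field,euclidean_space}) \<Rightarrow> ('i \<Rightarrow> 'b measure) \<Rightarrow>
     ('b set \<Rightarrow> 'f) \<Rightarrow> bool" where
  "represents T J c M \<omega> \<longleftrightarrow> finite J \<and> (\<forall>j\<in>J. nonneg_radon T (M j)) \<and>
     (\<forall>A. \<omega> A = (if A \<in> precompact_sets T then \<Sum>j\<in>J. measure (M j) A *\<^sub>R c j else 0))"

text \<open>Subtracting the two combinations, over the disjoint union of their index sets, leaves
  one that vanishes on all precompact sets, hence integrates f to 0.\<close>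

lemma represents_integral_unique:
  assumes T: "Hausdorff_space T" and r: "represents T J c M \<omega>" "represents T J' c' M' \<omega>"
    and f: "bounded_cs T f"
  shows "(\<Sum>j\<in>J. c j * integral\<^sup>L (M j) f) = (\<Sum>j\<in>J'. c' j * integral\<^sup>L (M' j) f)"
proof -
  have fin: "finite J" "finite J'"
    using r by (auto simp: represents_def)
  have "(\<Sum>j\<in>J <+> J'. case_sum c (\<lambda>j. - c' j) j * integral\<^sup>L (case_sum M M' j) f) = 0"
  proof (rule signed_combination_integral_zero[OF T _ _ f])
    show "nonneg_radon T (case_sum M M' j)" if "j \<in> J <+> J'" for j
      using r that by (auto simp: represents_def)
    fix A assume A: "A \<in> precompact_sets T"
    have "(\<Sum>j\<in>J. measure (M j) A *\<^sub>R c j) = \<omega> A" "(\<Sum>j\<in>J'. measure (M' j) A *\<^sub>R c' j) = \<omega> A"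
      using r A unfolding represents_def by metis+
    then show "(\<Sum>j\<in>J <+> J'. measure (case_sum M M' j) A *\<^sub>R case_sum c (\<lambda>j. - c' j) j) = 0"
      using fin by (simp add: sum.Plus sum_negf)
  qed
  then show ?thesis
    using fin by (simp add: sum.Plus sum_negf)
qed

text \<open>The values are compared on precompact sets only: elsewhere a mass may be infinite,
  \<open>measure\<close> turns it into 0, and the linear relation can fail.\<close>

lemma exists_combination_measure:
  fixes M :: "'i \<Rightarrow> 'b measure" and a :: "'i \<Rightarrow> real"
  assumes J: "finite J" and M: "\<And>j. j \<in> J \<Longrightarrow> nonneg_radon T (M j)" and T: "Hausdorff_space T"
    and a: "\<And>j. j \<in> J \<Longrightarrow> a j \<ge> 0"
  obtains N where "nonneg_radon T N"
    "\<And>A. A \<in> precompact_sets T \<Longrightarrow> measure N A = (\<Sum>j\<in>J. a j * measure (M j) A)"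
proof -
  define \<mu> where "\<mu> A = (\<Sum>j\<in>J. ennreal (a j) * emeasure (M j) A)" for A
  define N where "N = measure_of (topspace T) (sets (borel_of T)) \<mu>"
  have se: "sets N = sets (borel_of T)"
    using sets.space_closed[of "borel_of T"] by (simp add: N_def sets.sigma_sets_eq[of "borel_of T", simplified])
  have em: "emeasure N A = \<mu> A" if "A \<in> sets (borel_of T)" for A
  proof (rule emeasure_measure_of[OF N_def])
    show "sets (borel_of T) \<subseteq> Pow (topspace T)"
      using sets.space_closed[of "borel_of T"] by simp
    show "positive (sets N) \<mu>"
      by (simp add: positive_def \<mu>_def)
    show "countably_additive (sets N) \<mu>"
    proof (rule countably_additiveI)
      fix A :: "nat \<Rightarrow> 'b set" assume A: "range A \<subseteq> sets N" "disjoint_family A"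
      have "(\<Sum>i. \<mu> (A i)) = (\<Sum>j\<in>J. \<Sum>i. ennreal (a j) * emeasure (M j) (A i))"
        unfolding \<mu>_def by (intro suminf_sum) auto
      also have "\<dots> = (\<Sum>j\<in>J. ennreal (a j) * (\<Sum>i. emeasure (M j) (A i)))"
        by simp
      also have "\<dots> = \<mu> (\<Union>i. A i)"
        unfolding \<mu>_def
      proof (intro sum.cong refl arg_cong2[where f="(*)"] suminf_emeasure A)
        fix j assume "j \<in> J"
        then show "range A \<subseteq> sets (M j)"
          using A M se by (auto simp: nonneg_radon_def)
      qed
      finally show "(\<Sum>i. \<mu> (A i)) = \<mu> (\<Union>i. A i)" .
    qed
    show "A \<in> sets N" using that se by simp
  qed
  show ?thesis
  proof
    show "nonneg_radon T N"
      unfolding nonneg_radon_def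
    proof (intro conjI allI impI se)
      fix K assume K: "compactin T K"
      have "\<mu> K < \<infinity>"
        unfolding \<mu>_def using M K J
        by (auto simp: nonneg_radon_def ennreal_mult_less_top)
      then show "emeasure N K < \<infinity>"
        using em compactin_in_borel_of[OF T K] by simp
    qed
    fix A assume A: "A \<in> precompact_sets T"
    have fin: "emeasure (M j) A < \<infinity>" if "j \<in> J" for j
      using nonneg_radon_precompact[OF M[OF that] T A] by auto
    have "measure N A = enn2real (\<Sum>j\<in>J. ennreal (a j * measure (M j) A))"
      unfolding measure_def[of N] em[OF precompact_setsD(1)[OF A]] \<mu>_def
      using fin a
      by (intro arg_cong[where f=enn2real] sum.cong refl)
         (auto simp: ennreal_mult emeasure_eq_ennreal_measure less_top)
    also have "\<dots> = (\<Sum>j\<in>J. a j * measure (M j) A)"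
      using a by (subst sum_ennreal) (auto intro!: enn2real_ennreal sum_nonneg)
    finally show "measure N A = (\<Sum>j\<in>J. a j * measure (M j) A)" .
  qed
qed

lemma represents_imp_radon_decomposition:
  assumes T: "Hausdorff_space T" and r: "represents T J c M \<omega>"
  obtains P N where "radon_decomposition T \<omega> P N"
proof -
  have J: "finite J" and M: "\<And>j. j \<in> J \<Longrightarrow> nonneg_radon T (M j)"
    and \<omega>: "\<And>A. \<omega> A = (if A \<in> precompact_sets T then \<Sum>j\<in>J. measure (M j) A *\<^sub>R c j else 0)"
    using r by (auto simp: represents_def)
  \<comment> \<open>For s = 1 and s = -1 the weights are the positive and negative parts of the
    coordinates of \<open>c j\<close>; they recombine by
    \<open>max 0 t - max 0 (-t) = t\<close>.\<close>
  have "\<forall>s b. \<exists>P. nonneg_radon T P \<and> (\<forall>A\<in>precompact_sets T. measure P A = (\<Sum>j\<in>J. max 0 (s * (c j \<bullet> b)) * measure (M j) A))"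
  proof (intro allI)
    fix s b
    obtain P where "nonneg_radon T P"
      "\<And>A. A \<in> precompact_sets T \<Longrightarrow> measure P A = (\<Sum>j\<in>J. max 0 (s * (c j \<bullet> b)) * measure (M j) A)"
      by (rule exists_combination_measure[OF J M T, where a="\<lambda>j. max 0 (s * (c j \<bullet> b))"]) auto
    then show "\<exists>P. nonneg_radon T P \<and> (\<forall>A\<in>precompact_sets T. measure P A = (\<Sum>j\<in>J. max 0 (s * (c j \<bullet> b)) * measure (M j) A))"
      by blast
  qed
  then obtain P where "\<forall>s b. nonneg_radon T (P s b) \<and> (\<forall>A\<in>precompact_sets T. measure (P s b) A = (\<Sum>j\<in>J. max 0 (s * (c j \<bullet> b)) * measure (M j) A))"
    unfolding choice_iff by blast
  then have P: "\<And>s b. nonneg_radon T (P s b)"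
    "\<And>s b A. A \<in> precompact_sets T \<Longrightarrow> measure (P s b) A = (\<Sum>j\<in>J. max 0 (s * (c j \<bullet> b)) * measure (M j) A)"
    by blast+
  have "radon_decomposition T \<omega> (P 1) (P (-1))"
    unfolding radon_decomposition_def
  proof (intro conjI allI ballI P(1))
    fix A
    have "(\<Sum>j\<in>J. measure (M j) A *\<^sub>R c j) = (\<Sum>b\<in>Basis. (measure (P 1 b) A - measure (P (- 1) b) A) *\<^sub>R b)"
      if A: "A \<in> precompact_sets T"
    proof -
      have "(\<Sum>b\<in>Basis. (measure (P 1 b) A - measure (P (- 1) b) A) *\<^sub>R b)
          = (\<Sum>b\<in>Basis. (\<Sum>j\<in>J. (c j \<bullet> b) * measure (M j) A) *\<^sub>R b)"
        unfolding P(2)[OF A] sum_subtractf[symmetric] left_diff_distrib[symmetric]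
        by (intro sum.cong refl arg_cong2[where f="(*\<^sub>R)"] arg_cong2[where f="(*)"]) (auto simp: max_def)
      also have "\<dots> = (\<Sum>j\<in>J. measure (M j) A *\<^sub>R (\<Sum>b\<in>Basis. (c j \<bullet> b) *\<^sub>R b))"
        by (simp add: scaleR_sum_left scaleR_sum_right mult.commute) (rule sum.swap)
      finally show ?thesis
        by (simp add: euclidean_representation)
    qed
    then show "\<omega> A = (if A \<in> precompact_sets T
        then \<Sum>b\<in>Basis. (measure (P 1 b) A - measure (P (- 1) b) A) *\<^sub>R b else 0)"
      by (simp add: \<omega>)
  qed
  then show ?thesis by (rule that)
qed

lemma radon_decomposition_represents:
  fixes \<omega> :: "'b set \<Rightarrow> 'f::{real_normed_field,euclidean_space}"
  assumes "radon_decomposition T \<omega> P N"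
  shows "represents T ((Basis::'f set) \<times> (UNIV::bool set)) (\<lambda>(b,s). if s then b else - b)
           (\<lambda>(b,s). if s then P b else N b) \<omega>"
    and "(\<Sum>b\<in>Basis. b * (integral\<^sup>L (P b) f - integral\<^sup>L (N b) f)) =
      (\<Sum>j\<in>(Basis::'f set) \<times> (UNIV::bool set). (\<lambda>(b,s). if s then b else - b) j *
           integral\<^sup>L ((\<lambda>(b,s). if s then P b else N b) j) f)"
proof -
  have *: "(\<Sum>j\<in>(Basis::'f set) \<times> (UNIV::bool set). g j) = (\<Sum>b\<in>Basis. g (b, True) + g (b, False))"
    for g :: "'f \<times> bool \<Rightarrow> 'f"
    unfolding sum.cartesian_product' by (simp add: UNIV_bool add.commute)
  show "represents T ((Basis::'f set) \<times> (UNIV::bool set)) (\<lambda>(b,s). if s then b else - b)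
           (\<lambda>(b,s). if s then P b else N b) \<omega>"
    using assms unfolding represents_def radon_decomposition_def *
    by (auto simp: algebra_simps)
  show "(\<Sum>b\<in>Basis. b * (integral\<^sup>L (P b) f - integral\<^sup>L (N b) f)) =
      (\<Sum>j\<in>(Basis::'f set) \<times> (UNIV::bool set). (\<lambda>(b,s). if s then b else - b) j *
           integral\<^sup>L ((\<lambda>(b,s). if s then P b else N b) j) f)"
    unfolding * by (simp add: algebra_simps)
qed

text \<open>The description in \<open>radon_integral\<close> ranges over all decompositions, so
  evaluating it requires that one exists and that all give the same value. From here on any
  representation serves to compute the integral.\<close>

lemma represents_radon_integral:
  assumes T: "Hausdorff_space T" and r: "represents T J c M \<omega>" and f: "bounded_cs T f"
  shows "radon_integral T \<omega> f = (\<Sum>j\<in>J. c j * integral\<^sup>L (M j) f)"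
proof -
  have *: "(\<Sum>b\<in>Basis. b * (integral\<^sup>L (P b) f - integral\<^sup>L (N b) f)) = (\<Sum>j\<in>J. c j * integral\<^sup>L (M j) f)"
    if "radon_decomposition T \<omega> P N" for P N
    using represents_integral_unique[OF T radon_decomposition_represents(1)[OF that] r f]
      radon_decomposition_represents(2)[OF that] by simp
  obtain P N where PN: "radon_decomposition T \<omega> P N"
    by (rule represents_imp_radon_decomposition[OF T r])
  show ?thesis
    unfolding radon_integral_def
  proof (rule the_equality)
    show "\<exists>P N. radon_decomposition T \<omega> P N \<and>
        (\<Sum>j\<in>J. c j * integral\<^sup>L (M j) f) = (\<Sum>b\<in>Basis. b * (integral\<^sup>L (P b) f - integral\<^sup>L (N b) f))"
      using * PN by (intro exI[of _ P] exI[of _ N]) simp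
  qed (auto simp: *)
qed

lemma represents_radon_measures:
  "Hausdorff_space T \<Longrightarrow> represents T J c M \<omega> \<Longrightarrow> \<omega> \<in> radon_measures T"
  using represents_imp_radon_decomposition unfolding radon_measures_def by blast

lemma radon_measures_represents:
  fixes \<omega> :: "'b set \<Rightarrow> 'f::{real_normed_field,euclidean_space}"
  assumes "\<omega> \<in> radon_measures T"
  obtains c M where "represents T ((Basis::'f set) \<times> (UNIV::bool set)) c M \<omega>"
  using assms radon_decomposition_represents(1) unfolding radon_measures_def by blast

section \<open>Powers of the space\<close>

abbreviation power_algebra :: "nat \<Rightarrow> (nat \<Rightarrow> 'a::topological_space) measure" where
  "power_algebra n \<equiv> Pi\<^sub>M {..<n} (\<lambda>_. borel)"

lemma sets_borel_of_euclidean [simp]: "sets (borel_of euclidean) = sets borel"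
  by (simp add: borel_of_def borel_def)

lemma topspace_power_top [simp]: "topspace (power_top n) = (\<Pi>\<^sub>E i\<in>{..<n}. UNIV)"
  by (simp add: power_top_def)

lemma space_power_algebra [simp]: "space (power_algebra n) = (\<Pi>\<^sub>E i\<in>{..<n}. UNIV)"
  by (simp add: space_PiM)

lemma Hausdorff_power_top [simp]: "Hausdorff_space (power_top n :: (nat \<Rightarrow> 'a::metric_space) topology)"
  by (simp add: power_top_def Hausdorff_space_product_topology)

text \<open>For the inclusion from left to right, an open set \<open>U\<close> of the finite power is a section of the
  open cylinder over \<open>U\<close> in the countable power, where the Borel sets are known.\<close>

lemma sets_borel_of_power_top:
  "sets (borel_of (power_top n)) = sets (power_algebra n :: (nat \<Rightarrow> 'a::second_countable_topology) measure)"
proof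
  have "U \<in> sets (power_algebra n)" if U: "openin (power_top n) U" for U :: "(nat \<Rightarrow> 'a) set"
  proof -
    define r :: "(nat \<Rightarrow> 'a) \<Rightarrow> nat \<Rightarrow> 'a" where "r x = restrict x {..<n}" for x
    define e :: "(nat \<Rightarrow> 'a) \<Rightarrow> nat \<Rightarrow> 'a" where "e x = (\<lambda>i. if i < n then x i else undefined)" for x
    have "continuous_map (product_topology (\<lambda>_. euclidean) UNIV) (power_top n) r"
      unfolding power_top_def r_def
      by (subst continuous_map_componentwise) (auto intro!: continuous_map_product_projection)
    then have "openin euclidean (r -` U)"
      using openin_continuous_map_preimage[OF _ U, of euclidean r]
      by (simp add: euclidean_product_topology vimage_def)
    then have "r -` U \<in> sets (Pi\<^sub>M UNIV (\<lambda>_. borel))"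
      by (simp add: sets_PiM_equal_borel)
    moreover have "e \<in> measurable (power_algebra n) (Pi\<^sub>M UNIV (\<lambda>_. borel))"
    proof (rule measurable_PiM_single')
      show "(\<lambda>x. e x i) \<in> measurable (power_algebra n) borel" for i
        by (cases "i < n") (simp_all add: e_def measurable_component_singleton)
    qed simp
    ultimately have "e -` r -` U \<inter> space (power_algebra n) \<in> sets (power_algebra n)"
      by (rule measurable_sets[rotated])
    moreover have "e -` r -` U \<inter> space (power_algebra n) = U"
    proof -
      have "r (e x) = x" if "x \<in> (\<Pi>\<^sub>E i\<in>{..<n}. UNIV)" for x
        using that by (auto simp: r_def e_def PiE_def extensional_def fun_eq_iff)
      then show ?thesis
        using openin_subset[OF U] by auto
    qed
    ultimately show ?thesis by simp
  qed
  then show "sets (borel_of (power_top n)) \<subseteq> sets (power_algebra n :: (nat \<Rightarrow> 'a) measure)"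
    unfolding sets_borel_of
    using sets.sigma_sets_subset[of "{U. openin (power_top n) U}" "power_algebra n :: (nat \<Rightarrow> 'a) measure"] by auto
  have "(\<lambda>x. x) \<in> measurable (borel_of (power_top n)) (power_algebra n :: (nat \<Rightarrow> 'a) measure)"
  proof (rule measurable_PiM_single')
    fix i assume i: "i \<in> {..<n}"
    show "(\<lambda>x. x i :: 'a) \<in> measurable (borel_of (power_top n)) borel"
    proof (rule borel_measurableI)
      fix S :: "'a set" assume "open S"
      have "continuous_map (power_top n) euclidean (\<lambda>x. x i :: 'a)"
        using i unfolding power_top_def by (rule continuous_map_product_projection)
      then have "openin (power_top n) {x \<in> topspace (power_top n). x i \<in> S}"
        using \<open>open S\<close> by (intro openin_continuous_map_preimage) auto
      then show "(\<lambda>x. x i) -` S \<inter> space (borel_of (power_top n)) \<in> sets (borel_of (power_top n))"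
        unfolding sets_borel_of space_borel_of by (intro sigma_sets.Basic) (simp add: vimage_def Int_def conj_commute)
    qed
  qed simp
  then show "sets (power_algebra n :: (nat \<Rightarrow> 'a) measure) \<subseteq> sets (borel_of (power_top n))"
  proof -
    assume *: "(\<lambda>x. x) \<in> measurable (borel_of (power_top n)) (power_algebra n :: (nat \<Rightarrow> 'a) measure)"
    show ?thesis
    proof
      fix A :: "(nat \<Rightarrow> 'a) set" assume A: "A \<in> sets (power_algebra n)"
      have "(\<lambda>x. x) -` A \<inter> space (borel_of (power_top n)) = A"
        using sets.sets_into_space[OF A] by (auto simp: space_PiM)
      then show "A \<in> sets (borel_of (power_top n))"
        using measurable_sets[OF * A] by simp
    qed
  qed
qed

lemma measurable_borel_of_power_top:
  "measurable (borel_of (power_top n)) N = measurable (power_algebra n :: (nat \<Rightarrow> 'a::second_countable_topology) measure) N"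
  by (rule measurable_cong_sets) (auto simp: sets_borel_of_power_top)

section \<open>Compact supports in the powers\<close>

lemma compactin_power_box:
  "compact C \<Longrightarrow> compactin (power_top n) (\<Pi>\<^sub>E i\<in>{..<n}. C)"
  by (simp add: power_top_def compactin_PiE)

text \<open>A cube with one common side C passes to sections, diagonals and neighbouring powers with
  the same C, so compact supports are recorded through C. For n = 0 the side constructed here is
  empty, yet the cube is the one-point space.\<close>

lemma compactin_power_subset_box:
  assumes "compactin (power_top n) K"
  obtains C where "compact C" "K \<subseteq> (\<Pi>\<^sub>E i\<in>{..<n}. C)"
proof
  have "compactin euclidean ((\<lambda>x. x i) ` K)" if "i < n" for i
    using that assms unfolding power_top_def
    by (intro image_compactin) (auto intro: continuous_map_product_projection)
  then show "compact (\<Union>i<n. (\<lambda>x. x i) ` K)"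
    by (intro compact_UN) auto
  show "K \<subseteq> (\<Pi>\<^sub>E i\<in>{..<n}. (\<Union>i<n. (\<lambda>x. x i) ` K))"
  proof
    fix x assume x: "x \<in> K"
    then have "x \<in> (\<Pi>\<^sub>E i\<in>{..<n}. UNIV)"
      using compactin_subset_topspace[OF assms] by auto
    then show "x \<in> (\<Pi>\<^sub>E i\<in>{..<n}. (\<Union>i<n. (\<lambda>x. x i) ` K))"
      using x by (intro PiE_I) (auto simp: PiE_def extensional_def)
  qed
qed

lemma bounded_cs_power_iff:
  fixes f :: "(nat \<Rightarrow> 'a::polish_space) \<Rightarrow> 'f::{real_normed_field,euclidean_space}"
  shows "bounded_cs (power_top n) f \<longleftrightarrow> f \<in> borel_measurable (power_algebra n) \<and>
     (\<exists>B. \<forall>x. norm (f x) \<le> B) \<and> (\<exists>C. compact C \<and> (\<forall>x. x \<notin> (\<Pi>\<^sub>E i\<in>{..<n}. C) \<longrightarrow> f x = 0))"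
proof -
  have "(\<exists>K. compactin (power_top n) K \<and> (\<forall>x. x \<notin> K \<longrightarrow> f x = 0)) \<longleftrightarrow>
      (\<exists>C. compact C \<and> (\<forall>x. x \<notin> (\<Pi>\<^sub>E i\<in>{..<n}. C) \<longrightarrow> f x = 0))"
  proof
    assume "\<exists>K. compactin (power_top n) K \<and> (\<forall>x. x \<notin> K \<longrightarrow> f x = 0)"
    then obtain K where K: "compactin (power_top n) K" "\<forall>x. x \<notin> K \<longrightarrow> f x = 0"
      by blast
    obtain C where "compact C" "K \<subseteq> (\<Pi>\<^sub>E i\<in>{..<n}. C)"
      using K(1) by (rule compactin_power_subset_box)
    then show "\<exists>C. compact C \<and> (\<forall>x. x \<notin> (\<Pi>\<^sub>E i\<in>{..<n}. C) \<longrightarrow> f x = 0)"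
      using K(2) by (intro exI[of _ C]) blast
  next
    assume "\<exists>C. compact C \<and> (\<forall>x. x \<notin> (\<Pi>\<^sub>E i\<in>{..<n}. C) \<longrightarrow> f x = 0)"
    then obtain C where "compact C" "\<forall>x. x \<notin> (\<Pi>\<^sub>E i\<in>{..<n}. C) \<longrightarrow> f x = 0"
      by blast
    then show "\<exists>K. compactin (power_top n) K \<and> (\<forall>x. x \<notin> K \<longrightarrow> f x = 0)"
      by (intro exI[of _ "\<Pi>\<^sub>E i\<in>{..<n}. C"] conjI compactin_power_box)
  qed
  then show ?thesis
    by (simp add: bounded_cs_def measurable_borel_of_power_top)
qed

lemma bounded_cs_powerI:
  fixes f :: "(nat \<Rightarrow> 'a::polish_space) \<Rightarrow> 'f::{real_normed_field,euclidean_space}"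
  assumes "f \<in> borel_measurable (power_algebra n)" "\<And>x. norm (f x) \<le> B"
    "compact C" "\<And>x. x \<notin> (\<Pi>\<^sub>E i\<in>{..<n}. C) \<Longrightarrow> f x = 0"
  shows "bounded_cs (power_top n) f"
  unfolding bounded_cs_power_iff using assms by (intro conjI exI[of _ B] exI[of _ C]) auto

lemma bounded_cs_powerE:
  fixes f :: "(nat \<Rightarrow> 'a::polish_space) \<Rightarrow> 'f::{real_normed_field,euclidean_space}"
  assumes "bounded_cs (power_top n) f"
  obtains B C where "f \<in> borel_measurable (power_algebra n)" "\<And>x. norm (f x) \<le> B" "B \<ge> 0"
    "compact C" "\<And>x. x \<notin> (\<Pi>\<^sub>E i\<in>{..<n}. C) \<Longrightarrow> f x = 0"
proof -
  obtain B C where *: "f \<in> borel_measurable (power_algebra n)" "\<And>x. norm (f x) \<le> B"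
    "compact C" "\<And>x. x \<notin> (\<Pi>\<^sub>E i\<in>{..<n}. C) \<Longrightarrow> f x = 0"
    using assms unfolding bounded_cs_power_iff by blast
  moreover have "B \<ge> 0"
    using *(2) norm_ge_zero order_trans by blast
  ultimately show ?thesis using that by blast
qed

lemma bounded_cs_power_outside:
  fixes f :: "(nat \<Rightarrow> 'a::polish_space) \<Rightarrow> 'f::{real_normed_field,euclidean_space}"
  assumes "bounded_cs (power_top n) f" "x \<notin> topspace (power_top n)"
  shows "f x = 0"
  using assms by (elim bounded_cs_powerE) (auto simp: PiE_def)

lemma bounded_cs_euclideanI:
  fixes f :: "'a::topological_space \<Rightarrow> 'f::{real_normed_field,euclidean_space}"
  assumes "f \<in> borel_measurable borel" "\<And>x. norm (f x) \<le> B"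
    "compact C" "\<And>x. x \<notin> C \<Longrightarrow> f x = 0"
  shows "bounded_cs euclidean f"
proof -
  have "f \<in> borel_measurable (borel_of euclidean)"
    using assms(1) by (simp add: measurable_cong_sets[OF sets_borel_of_euclidean refl])
  then show ?thesis
    using assms unfolding bounded_cs_def by auto
qed

text \<open>By local compactness the open sets contained in compact ones cover the space, and
  Lindelof extracts a countable subfamily. This is where local compactness enters; the
  sigma-finiteness behind Fubini rests on it.\<close>

lemma countable_compact_cover:
  assumes "locally_compact_space (euclidean :: 'a::second_countable_topology topology)"
  obtains \<C> :: "'a::second_countable_topology set set" where "countable \<C>" "\<And>C. C \<in> \<C> \<Longrightarrow> compact C" "\<Union>\<C> = UNIV"
proof -
  define \<U> where "\<U> = {U :: 'a set. open U \<and> (\<exists>K. compact K \<and> U \<subseteq> K)}"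
  have "\<And>U. U \<in> \<U> \<Longrightarrow> open U"
    by (auto simp: \<U>_def)
  then obtain \<V> where \<V>: "\<V> \<subseteq> \<U>" "countable \<V>" "\<Union>\<V> = \<Union>\<U>"
    using Lindelof by blast
  have "x \<in> \<Union>\<U>" for x
    using assms unfolding locally_compact_space_def \<U>_def by fastforce
  then have UN: "\<Union>\<V> = UNIV"
    using \<V> by auto
  have "\<forall>U\<in>\<V>. \<exists>K. compact K \<and> U \<subseteq> K"
    using \<V>(1) by (auto simp: \<U>_def)
  then obtain K where K: "\<And>U. U \<in> \<V> \<Longrightarrow> compact (K U) \<and> U \<subseteq> K U"
    by metis
  show ?thesis
  proof
    show "countable (K ` \<V>)" using \<V> by simp
    show "\<Union>(K ` \<V>) = UNIV" using UN K by blast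
  qed (use K in auto)
qed

lemma sigma_finite_nonneg_radon:
  assumes "locally_compact_space (euclidean :: 'a::polish_space topology)"
    and "nonneg_radon (euclidean :: 'a topology) \<mu>"
  shows "sigma_finite_measure \<mu>"
proof -
  obtain \<C> :: "'a set set" where \<C>: "countable \<C>" "\<And>C. C \<in> \<C> \<Longrightarrow> compact C" "\<Union>\<C> = UNIV"
    using countable_compact_cover[OF assms(1)] by blast
  show ?thesis
  proof (rule sigma_finite_measure.intro, intro exI[of _ \<C>] conjI ballI)
    show "\<C> \<subseteq> sets \<mu>"
      using \<C>(2) assms(2) by (auto simp: nonneg_radon_def borel_compact)
    show "\<Union>\<C> = space \<mu>"
      using \<C>(3) nonneg_radon_space[OF assms(2)] by simp
    show "emeasure \<mu> C \<noteq> \<infinity>" if "C \<in> \<C>" for C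
      using \<C>(2)[OF that] assms(2) by (auto simp: nonneg_radon_def)
  qed (rule \<C>)
qed

lemma sigma_finite_nonneg_radon_power:
  assumes "locally_compact_space (euclidean :: 'a::polish_space topology)"
    and "nonneg_radon (power_top n :: (nat \<Rightarrow> 'a) topology) \<mu>"
  shows "sigma_finite_measure \<mu>"
proof -
  obtain \<C> :: "'a set set" where \<C>: "countable \<C>" "\<And>C. C \<in> \<C> \<Longrightarrow> compact C" "\<Union>\<C> = UNIV"
    using countable_compact_cover[OF assms(1)] by blast
  \<comment> \<open>The sets of the cover need not be increasing, so cubes would not exhaust the
    power; the sides are chosen independently.\<close>
  define \<D> where "\<D> = (\<lambda>F. \<Pi>\<^sub>E i\<in>{..<n}. F i) ` (\<Pi>\<^sub>E i\<in>{..<n}. \<C>)"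
  have compact: "compactin (power_top n) D" if "D \<in> \<D>" for D
  proof -
    obtain F where F: "F \<in> (\<Pi>\<^sub>E i\<in>{..<n}. \<C>)" "D = (\<Pi>\<^sub>E i\<in>{..<n}. F i)"
      using \<open>D \<in> \<D>\<close> unfolding \<D>_def by blast
    have "compact (F i)" if "i < n" for i
      using \<C>(2) F(1) that by blast
    then show ?thesis
      by (simp add: F(2) power_top_def compactin_PiE)
  qed
  show ?thesis
  proof (rule sigma_finite_measure.intro, intro exI[of _ \<D>] conjI ballI)
    show "countable \<D>"
      unfolding \<D>_def using \<C>(1) by (intro countable_image countable_PiE) auto
    show "\<D> \<subseteq> sets \<mu>"
      using compactin_in_borel_of[OF Hausdorff_power_top compact] assms(2) by (auto simp: nonneg_radon_def)
    show "\<Union>\<D> = space \<mu>"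
    proof
      show "\<Union>\<D> \<subseteq> space \<mu>"
        using nonneg_radon_space[OF assms(2)] by (auto simp: \<D>_def)
      show "space \<mu> \<subseteq> \<Union>\<D>"
      proof
        fix x assume x: "x \<in> space \<mu>"
        have "\<forall>i. \<exists>C\<in>\<C>. x i \<in> C"
          using \<C>(3) by blast
        then obtain F where F: "\<And>i. F i \<in> \<C> \<and> x i \<in> F i"
          by metis
        have "x \<in> (\<Pi>\<^sub>E i\<in>{..<n}. restrict F {..<n} i)"
          using x F nonneg_radon_space[OF assms(2)] by (auto simp: PiE_def)
        moreover have "restrict F {..<n} \<in> (\<Pi>\<^sub>E i\<in>{..<n}. \<C>)"
          using F by auto
        ultimately show "x \<in> \<Union>\<D>"
          unfolding \<D>_def by blast
      qed
    qed
    show "emeasure \<mu> D \<noteq> \<infinity>" if "D \<in> \<D>" for D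
      using compact[OF that] assms(2) by (auto simp: nonneg_radon_def)
  qed
qed

text \<open>Position i of the argument of f receives coordinate \<open>\<sigma> i\<close> of x. A
  permutation thus renames variables, while a map that is not injective restricts f to the diagonal
  on which the positions in each fibre of \<sigma> carry the same point. \<open>restrict\<close> and
  the value 0 follow the conventions for points of, and functions on, the powers.\<close>

definition pullback ::
    "nat \<Rightarrow> nat \<Rightarrow> (nat \<Rightarrow> nat) \<Rightarrow> ((nat \<Rightarrow> 'a::topological_space) \<Rightarrow> 'f::zero) \<Rightarrow> (nat \<Rightarrow> 'a) \<Rightarrow> 'f" where
  "pullback n k \<sigma> f x = (if x \<in> topspace (power_top k) then f (restrict (x \<circ> \<sigma>) {..<n}) else 0)"

text \<open>Surjectivity of \<sigma> keeps the support compact: every coordinate of x occurs in the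
  argument of f, so one coordinate outside C already makes f vanish.\<close>

lemma bounded_cs_pullback:
  fixes f :: "(nat \<Rightarrow> 'a::polish_space) \<Rightarrow> 'f::{real_normed_field,euclidean_space}"
  assumes f: "bounded_cs (power_top n) f" and \<sigma>: "\<sigma> ` {..<n} = {..<k}"
  shows "bounded_cs (power_top k) (pullback n k \<sigma> f)"
proof -
  obtain B C where *: "f \<in> borel_measurable (power_algebra n)" "\<And>x. norm (f x) \<le> B" "B \<ge> 0"
    "compact C" "\<And>x. x \<notin> (\<Pi>\<^sub>E i\<in>{..<n}. C) \<Longrightarrow> f x = 0"
    using f by (rule bounded_cs_powerE) blast
  show ?thesis
  proof (rule bounded_cs_powerI)
    have "(\<lambda>x. restrict (x \<circ> \<sigma>) {..<n}) \<in> measurable (power_algebra k) (power_algebra n :: (nat \<Rightarrow> 'a) measure)"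
      unfolding comp_def restrict_def[symmetric]
    proof (rule measurable_restrict)
      fix i assume "i \<in> {..<n}"
      then have "\<sigma> i \<in> {..<k}" using \<sigma> by blast
      then show "(\<lambda>x. x (\<sigma> i) :: 'a) \<in> measurable (power_algebra k) borel"
        by (rule measurable_component_singleton)
    qed
    from measurable_compose[OF this *(1)]
    have "(\<lambda>x. f (restrict (x \<circ> \<sigma>) {..<n})) \<in> borel_measurable (power_algebra k)" .
    then show "pullback n k \<sigma> f \<in> borel_measurable (power_algebra k)"
      by (rule measurable_cong[THEN iffD1, rotated]) (simp add: pullback_def)
    show "norm (pullback n k \<sigma> f x) \<le> B" for x
      using *(2,3) by (simp add: pullback_def)
    show "pullback n k \<sigma> f x = 0" if x: "x \<notin> (\<Pi>\<^sub>E i\<in>{..<k}. C)" for x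
    proof (cases "x \<in> topspace (power_top k)")
      case True
      then obtain i where "i < k" "x i \<notin> C"
        using x by (auto simp: PiE_def)
      moreover obtain j where "j < n" "\<sigma> j = i"
        using \<sigma> \<open>i < k\<close> by (metis imageE lessThan_iff)
      ultimately have "restrict (x \<circ> \<sigma>) {..<n} \<notin> (\<Pi>\<^sub>E i\<in>{..<n}. C)"
        by (auto simp: PiE_def Pi_def)
      then show ?thesis
        using *(5) by (simp add: pullback_def)
    qed (simp add: pullback_def)
  qed (rule *)
qed

lemma bounded_cs_section:
  fixes f :: "(nat \<Rightarrow> 'a::polish_space) \<Rightarrow> 'f::{real_normed_field,euclidean_space}"
  assumes f: "bounded_cs (power_top (Suc n)) f" and x: "x \<in> topspace (power_top n)"
  shows "bounded_cs euclidean (\<lambda>y. f (x(n := y)))"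
proof -
  obtain B C where *: "f \<in> borel_measurable (power_algebra (Suc n))" "\<And>x. norm (f x) \<le> B" "B \<ge> 0"
    "compact C" "\<And>x. x \<notin> (\<Pi>\<^sub>E i\<in>{..<Suc n}. C) \<Longrightarrow> f x = 0"
    using f by (rule bounded_cs_powerE) blast
  show ?thesis
  proof (rule bounded_cs_euclideanI)
    have "(\<lambda>y. x(n := y)) \<in> measurable borel (Pi\<^sub>M (insert n {..<n}) (\<lambda>_. borel))"
      using x by (intro measurable_fun_upd[where J="{..<n}"]) auto
    then have "(\<lambda>y. x(n := y)) \<in> measurable borel (power_algebra (Suc n))"
      by (simp add: lessThan_Suc)
    from measurable_compose[OF this *(1)]
    show "(\<lambda>y. f (x(n := y))) \<in> borel_measurable borel" .
    show "f (x(n := y)) = 0" if "y \<notin> C" for y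
      using that by (intro *(5)) (auto simp: PiE_def Pi_def)
  qed (use * in auto)
qed

section \<open>Product measures and falling powers\<close>

lemma radon_integral_add:
  fixes f g :: "'b \<Rightarrow> 'f::{real_normed_field,euclidean_space}"
  assumes "Hausdorff_space T" "\<omega> \<in> radon_measures T" "bounded_cs T f" "bounded_cs T g"
  shows "radon_integral T \<omega> (\<lambda>x. f x + g x) = radon_integral T \<omega> f + radon_integral T \<omega> g"
proof -
  obtain c M where r: "represents T ((Basis :: 'f set) \<times> (UNIV::bool set)) c M \<omega>"
    using assms(2) by (rule radon_measures_represents)
  have "integral\<^sup>L (M j) (\<lambda>x. f x + g x) = integral\<^sup>L (M j) f + integral\<^sup>L (M j) g"
    if "j \<in> (Basis :: 'f set) \<times> UNIV" for j
    using r that assms unfolding represents_def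
    by (intro Bochner_Integration.integral_add nonneg_radon_integrable) auto
  then show ?thesis
    by (simp add: represents_radon_integral[OF assms(1) r] assms bounded_cs_add distrib_left sum.distrib)
qed

lemma radon_integral_mult_left:
  fixes f :: "'b \<Rightarrow> 'f::{real_normed_field,euclidean_space}"
  assumes "Hausdorff_space T" "\<omega> \<in> radon_measures T" "bounded_cs T f"
  shows "radon_integral T \<omega> (\<lambda>x. a * f x) = a * radon_integral T \<omega> f"
proof -
  obtain c M where r: "represents T ((Basis :: 'f set) \<times> (UNIV::bool set)) c M \<omega>"
    using assms(2) by (rule radon_measures_represents)
  show ?thesis
    by (simp add: represents_radon_integral[OF assms(1) r] assms bounded_cs_mult_left sum_distrib_left
        mult.left_commute)
qed

lemma radon_integral_zero:
  assumes "Hausdorff_space T" "\<omega> \<in> radon_measures T"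
  shows "radon_integral T \<omega> (\<lambda>_. 0) = 0"
  using radon_integral_mult_left[OF assms bounded_cs_zero, of 0] by simp

lemma radon_integral_diff:
  assumes "Hausdorff_space T" "\<omega> \<in> radon_measures T" "bounded_cs T f" "bounded_cs T g"
  shows "radon_integral T \<omega> (\<lambda>x. f x - g x) = radon_integral T \<omega> f - radon_integral T \<omega> g"
  using radon_integral_add[OF assms(1-3) bounded_cs_mult_left[OF assms(4)], of "-1"]
    radon_integral_mult_left[OF assms(1,2,4), of "-1"] by simp

lemma radon_integral_sum:
  assumes "Hausdorff_space T" "\<omega> \<in> radon_measures T" "\<And>i. i \<in> I \<Longrightarrow> bounded_cs T (f i)"
  shows "radon_integral T \<omega> (\<lambda>x. \<Sum>i\<in>I. f i x) = (\<Sum>i\<in>I. radon_integral T \<omega> (f i))"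
  using assms(3)
  by (induction I rule: infinite_finite_induct)
     (simp_all add: radon_integral_zero radon_integral_add bounded_cs_sum assms(1,2))

lemma integral_indicator_field:
  assumes "A \<in> sets M" "emeasure M A < \<infinity>"
  shows "integral\<^sup>L M (indicator A :: 'b \<Rightarrow> 'f::{real_normed_field,euclidean_space}) = of_real (measure M A)"
proof -
  have "integral\<^sup>L M (indicator A :: 'b \<Rightarrow> 'f) = (\<integral>x. indicator A x *\<^sub>R 1 \<partial>M)"
    by (intro Bochner_Integration.integral_cong) (auto simp: indicator_def)
  also have "\<dots> = (\<integral>x. indicator A x \<partial>M) *\<^sub>R 1"
    using assms by (intro integral_scaleR_left) auto
  also have "(\<integral>x. indicator A x \<partial>M) = measure M A"
    using assms by simp
  finally show ?thesis
    by (simp add: of_real_def)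
qed

lemma represents_indicator:
  fixes c :: "'i \<Rightarrow> 'f::{real_normed_field,euclidean_space}"
  assumes "Hausdorff_space T" "\<And>j. j \<in> J \<Longrightarrow> nonneg_radon T (M j)" "A \<in> precompact_sets T"
  shows "(\<Sum>j\<in>J. c j * integral\<^sup>L (M j) (indicator A)) = (\<Sum>j\<in>J. measure (M j) A *\<^sub>R c j)"
  using nonneg_radon_precompact[OF assms(2,1,3)]
  by (intro sum.cong refl) (simp add: integral_indicator_field scaleR_conv_of_real)

lemma radon_integral_indicator:
  fixes \<omega> :: "'b set \<Rightarrow> 'f::{real_normed_field,euclidean_space}"
  assumes T: "Hausdorff_space T" and \<omega>: "\<omega> \<in> radon_measures T" and A: "A \<in> precompact_sets T"
  shows "radon_integral T \<omega> (indicator A) = \<omega> A"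
proof -
  obtain c M where r: "represents T ((Basis :: 'f set) \<times> (UNIV::bool set)) c M \<omega>"
    using \<omega> by (rule radon_measures_represents)
  have "\<omega> A = (\<Sum>j\<in>(Basis :: 'f set) \<times> (UNIV::bool set). measure (M j) A *\<^sub>R c j)"
    using r A unfolding represents_def by metis
  moreover have "\<And>j. j \<in> (Basis :: 'f set) \<times> (UNIV::bool set) \<Longrightarrow> nonneg_radon T (M j)"
    using r unfolding represents_def by blast
  ultimately show ?thesis
    by (simp add: represents_radon_integral[OF T r bounded_cs_indicator[OF A]] represents_indicator[OF T _ A])
qed

lemma measurable_append_point:
  fixes P :: "(nat \<Rightarrow> 'a::polish_space) measure"
  assumes "sets P = sets (power_algebra n)" and "nonneg_radon (euclidean :: 'a topology) Q"
  shows "(\<lambda>(x, y). x(n := y)) \<in> measurable (P \<Otimes>\<^sub>M Q) (borel_of (power_top (Suc n)))"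
proof -
  have "(\<lambda>(x, y). x(n := y)) \<in> measurable (power_algebra n \<Otimes>\<^sub>M borel)
      (Pi\<^sub>M (insert n {..<n}) (\<lambda>_. borel :: 'a measure))"
    by (rule measurable_add_dim)
  moreover have "insert n {..<n} = {..<Suc n}"
    by (simp add: lessThan_Suc)
  moreover have "measurable (P \<Otimes>\<^sub>M Q) (borel_of (power_top (Suc n))) =
      measurable (power_algebra n \<Otimes>\<^sub>M borel) (power_algebra (Suc n) :: (nat \<Rightarrow> 'a) measure)"
    using assms
    by (intro measurable_cong_sets sets_pair_measure_cong sets_borel_of_power_top) (simp_all add: nonneg_radon_def)
  ultimately show ?thesis
    by simp
qed

lemma bounded_cs_integral_last:
  fixes f :: "(nat \<Rightarrow> 'a::polish_space) \<Rightarrow> 'f::{real_normed_field,euclidean_space}"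
  assumes lc: "locally_compact_space (euclidean :: 'a topology)" and Q: "nonneg_radon euclidean Q"
    and f: "bounded_cs (power_top (Suc n)) f"
  shows "bounded_cs (power_top n)
           (\<lambda>x. if x \<in> topspace (power_top n) then \<integral>y. f (x(n := y)) \<partial>Q else 0)"
proof -
  interpret Q: sigma_finite_measure Q
    using sigma_finite_nonneg_radon[OF lc Q] .
  obtain B C where *: "f \<in> borel_measurable (power_algebra (Suc n))" "\<And>x. norm (f x) \<le> B" "B \<ge> 0"
    "compact C" "\<And>x. x \<notin> (\<Pi>\<^sub>E i\<in>{..<Suc n}. C) \<Longrightarrow> f x = 0"
    using f by (rule bounded_cs_powerE) blast
  have CQ: "C \<in> sets Q" "emeasure Q C < \<infinity>"
    using * Q by (auto simp: nonneg_radon_def borel_compact)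
  have fm: "f \<in> borel_measurable (borel_of (power_top (Suc n)))"
    using f by (simp add: bounded_cs_def)
  show ?thesis
  proof (rule bounded_cs_powerI)
    have "(\<lambda>z. f (case z of (x, y) \<Rightarrow> x(n := y))) \<in> borel_measurable (power_algebra n \<Otimes>\<^sub>M Q)"
      using measurable_compose[OF measurable_append_point[OF refl Q] fm] .
    then have "case_prod (\<lambda>x y. f (x(n := y))) \<in> borel_measurable (power_algebra n \<Otimes>\<^sub>M Q)"
      by (simp add: case_prod_unfold)
    then have "(\<lambda>x. \<integral>y. f (x(n := y)) \<partial>Q) \<in> borel_measurable (power_algebra n)"
      by (rule Q.borel_measurable_lebesgue_integral)
    then show "(\<lambda>x. if x \<in> topspace (power_top n) then \<integral>y. f (x(n := y)) \<partial>Q else 0)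
        \<in> borel_measurable (power_algebra n)"
      by (rule measurable_cong[THEN iffD1, rotated]) simp
    fix x
    have zero: "f (x(n := y)) = 0" if "y \<notin> C" for y
      using that by (intro *(5)) (auto simp: PiE_def Pi_def)
    show "norm (if x \<in> topspace (power_top n) then \<integral>y. f (x(n := y)) \<partial>Q else 0) \<le> B * measure Q C"
    proof (cases "x \<in> topspace (power_top n)")
      case True
      have int: "integrable Q (\<lambda>y. f (x(n := y)))"
        using nonneg_radon_integrable[OF Q _ bounded_cs_section[OF f True]] by simp
      have "norm (\<integral>y. f (x(n := y)) \<partial>Q) \<le> (\<integral>y. norm (f (x(n := y))) \<partial>Q)"
        by (rule integral_norm_bound)
      also have "\<dots> \<le> (\<integral>y. B * indicator C y \<partial>Q)"
      proof (rule integral_mono)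
        show "integrable Q (\<lambda>y. B * indicator C y)"
          using CQ by (intro integrable_mult_right integrable_real_indicator)
        show "norm (f (x(n := y))) \<le> B * indicator C y" for y
          using *(2) zero by (auto simp: indicator_def)
      qed (use int in auto)
      also have "\<dots> = B * measure Q C"
        using CQ by simp
      finally show ?thesis using True by simp
    qed (use *(3) in auto)
    show "(if x \<in> topspace (power_top n) then \<integral>y. f (x(n := y)) \<partial>Q else 0) = 0"
      if x: "x \<notin> (\<Pi>\<^sub>E i\<in>{..<n}. C)"
    proof (cases "x \<in> topspace (power_top n)")
      case True
      then obtain i where "i < n" "x i \<notin> C"
        using x by (auto simp: PiE_def)
      then have "f (x(n := y)) = 0" for y
        by (intro *(5)) (auto simp: PiE_def Pi_def)
      then show ?thesis by simp
    qed auto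
  qed (rule *)
qed

section \<open>Joint measures on the next power\<close>

context
  fixes n :: nat and P :: "(nat \<Rightarrow> 'a::polish_space) measure" and Q :: "'a measure"
  assumes lc: "locally_compact_space (euclidean :: 'a topology)"
    and P: "nonneg_radon (power_top n) P" and Q: "nonneg_radon euclidean Q"
begin

lemma sets_eq_power_algebra: "sets P = sets (power_algebra n)"
  using P by (simp add: nonneg_radon_def sets_borel_of_power_top)

definition product_distr :: "(nat \<Rightarrow> 'a) measure" where
  "product_distr = distr (P \<Otimes>\<^sub>M Q) (borel_of (power_top (Suc n))) (\<lambda>(x, y). x(n := y))"

lemma nonneg_radon_product_distr: "nonneg_radon (power_top (Suc n)) product_distr"
  unfolding nonneg_radon_def
proof (intro conjI allI impI)
  show "sets product_distr = sets (borel_of (power_top (Suc n)))"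
    by (simp add: product_distr_def)
  interpret Q: sigma_finite_measure Q
    using sigma_finite_nonneg_radon[OF lc Q] .
  fix K :: "(nat \<Rightarrow> 'a) set" assume K: "compactin (power_top (Suc n)) K"
  obtain C where C: "compact C" "K \<subseteq> (\<Pi>\<^sub>E i\<in>{..<Suc n}. C)"
    using K by (rule compactin_power_subset_box)
  define L where "L = (\<Pi>\<^sub>E i\<in>{..<n}. C)"
  have CQ: "C \<in> sets Q" "emeasure Q C < \<infinity>"
    using C Q by (auto simp: nonneg_radon_def borel_compact)
  have LP: "L \<in> sets P" "emeasure P L < \<infinity>"
    using P compactin_in_borel_of[OF Hausdorff_power_top compactin_power_box[OF C(1)]]
      compactin_power_box[OF C(1)] by (auto simp: nonneg_radon_def L_def)
  have "emeasure product_distr K \<le> emeasure (P \<Otimes>\<^sub>M Q) (L \<times> C)"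
    unfolding product_distr_def
  proof (subst emeasure_distr[OF measurable_append_point[OF sets_eq_power_algebra Q]])
    show "K \<in> sets (borel_of (power_top (Suc n)))"
      using K by (intro compactin_in_borel_of Hausdorff_power_top)
    show "emeasure (P \<Otimes>\<^sub>M Q) ((\<lambda>(x, y). x(n := y)) -` K \<inter> space (P \<Otimes>\<^sub>M Q)) \<le> emeasure (P \<Otimes>\<^sub>M Q) (L \<times> C)"
    proof (rule emeasure_mono)
      show "L \<times> C \<in> sets (P \<Otimes>\<^sub>M Q)"
        using LP CQ by simp
      show "(\<lambda>(x, y). x(n := y)) -` K \<inter> space (P \<Otimes>\<^sub>M Q) \<subseteq> L \<times> C"
      proof (clarsimp simp: space_pair_measure nonneg_radon_space[OF P] nonneg_radon_space[OF Q])
        fix x y assume x: "x(n := y) \<in> K" "x \<in> (\<Pi>\<^sub>E i\<in>{..<n}. UNIV)"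
        have *: "(x(n := y)) i \<in> C" if "i < Suc n" for i
          using PiE_mem[OF subsetD[OF C(2) x(1)], of i] that by simp
        have "x i \<in> C" if "i < n" for i
          using *[of i] that by simp
        then show "x \<in> L \<and> y \<in> C"
          using *[of n] x(2) unfolding L_def by (auto simp: PiE_def)
      qed
    qed
  qed
  also have "\<dots> = emeasure P L * emeasure Q C"
    using LP CQ by (intro Q.emeasure_pair_measure_Times)
  also have "\<dots> < \<infinity>"
    using LP CQ by (simp add: ennreal_mult_less_top)
  finally show "emeasure product_distr K < \<infinity>" .
qed

lemma integral_product_distr:
  fixes f :: "(nat \<Rightarrow> 'a) \<Rightarrow> 'f::{real_normed_field,euclidean_space}"
  assumes f: "bounded_cs (power_top (Suc n)) f"
  shows "integral\<^sup>L product_distr f = (\<integral>x. (\<integral>y. f (x(n := y)) \<partial>Q) \<partial>P)"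
proof -
  interpret pair_sigma_finite P Q
    using sigma_finite_nonneg_radon[OF lc Q] sigma_finite_nonneg_radon_power[OF lc P]
    by (simp add: pair_sigma_finite_def)
  have fm: "f \<in> borel_measurable (borel_of (power_top (Suc n)))"
    using f by (simp add: bounded_cs_def)
  have "integrable product_distr f"
    using nonneg_radon_integrable[OF nonneg_radon_product_distr Hausdorff_power_top f] .
  then have int: "integrable (P \<Otimes>\<^sub>M Q) (\<lambda>z. f (case z of (x, y) \<Rightarrow> x(n := y)))"
    unfolding product_distr_def integrable_distr_eq[OF measurable_append_point[OF sets_eq_power_algebra Q] fm] .
  have "integral\<^sup>L product_distr f = (\<integral>z. f (case z of (x, y) \<Rightarrow> x(n := y)) \<partial>(P \<Otimes>\<^sub>M Q))"
    unfolding product_distr_def using integral_distr[OF measurable_append_point[OF sets_eq_power_algebra Q] fm] .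
  also have "\<dots> = (\<integral>x. (\<integral>y. f (x(n := y)) \<partial>Q) \<partial>P)"
    using integral_fst'[OF int] by simp
  finally show ?thesis .
qed

end

context
  fixes n :: nat and P :: "(nat \<Rightarrow> 'a::polish_space) measure"
  assumes P: "nonneg_radon (power_top n) P"
begin

text \<open>The measure P(dx) times the Dirac measure at \<open>x i\<close>, that is, one of the
  terms subtracted by the kernel of the falling power.\<close>

definition diagonal_distr :: "nat \<Rightarrow> (nat \<Rightarrow> 'a) measure" where
  "diagonal_distr i = distr P (borel_of (power_top (Suc n))) (\<lambda>x. x(n := x i))"

lemma measurable_diagonal:
  assumes "i < n"
  shows "(\<lambda>x. x(n := x i)) \<in> measurable P (borel_of (power_top (Suc n)))"
proof -
  have "(\<lambda>x. x(n := x i)) \<in> measurable (power_algebra n) (Pi\<^sub>M (insert n {..<n}) (\<lambda>_. borel :: 'a measure))"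
    using assms by (intro measurable_fun_upd[where J="{..<n}"] measurable_component_singleton measurable_ident_sets) auto
  moreover have "insert n {..<n} = {..<Suc n}"
    by (simp add: lessThan_Suc)
  moreover have "measurable P (borel_of (power_top (Suc n))) =
      measurable (power_algebra n) (power_algebra (Suc n) :: (nat \<Rightarrow> 'a) measure)"
    using P by (intro measurable_cong_sets) (simp_all add: nonneg_radon_def sets_borel_of_power_top)
  ultimately show ?thesis
    by simp
qed

lemma nonneg_radon_diagonal_distr:
  assumes i: "i < n"
  shows "nonneg_radon (power_top (Suc n)) (diagonal_distr i)"
  unfolding nonneg_radon_def
proof (intro conjI allI impI)
  show "sets (diagonal_distr i) = sets (borel_of (power_top (Suc n)))"
    by (simp add: diagonal_distr_def)
  fix K :: "(nat \<Rightarrow> 'a) set" assume K: "compactin (power_top (Suc n)) K"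
  obtain C where C: "compact C" "K \<subseteq> (\<Pi>\<^sub>E i\<in>{..<Suc n}. C)"
    using K by (rule compactin_power_subset_box)
  define L where "L = (\<Pi>\<^sub>E i\<in>{..<n}. C)"
  have LP: "L \<in> sets P" "emeasure P L < \<infinity>"
    using P compactin_in_borel_of[OF Hausdorff_power_top compactin_power_box[OF C(1)]]
      compactin_power_box[OF C(1)] by (auto simp: nonneg_radon_def L_def)
  have "emeasure (diagonal_distr i) K \<le> emeasure P L"
    unfolding diagonal_distr_def
  proof (subst emeasure_distr[OF measurable_diagonal[OF i]])
    show "K \<in> sets (borel_of (power_top (Suc n)))"
      using K by (intro compactin_in_borel_of Hausdorff_power_top)
    show "emeasure P ((\<lambda>x. x(n := x i)) -` K \<inter> space P) \<le> emeasure P L"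
    proof (rule emeasure_mono[OF _ LP(1)])
      show "(\<lambda>x. x(n := x i)) -` K \<inter> space P \<subseteq> L"
      proof (clarsimp simp: nonneg_radon_space[OF P])
        fix x assume x: "x(n := x i) \<in> K" "x \<in> (\<Pi>\<^sub>E i\<in>{..<n}. UNIV)"
        have *: "(x(n := x i)) j \<in> C" if "j < Suc n" for j
          using PiE_mem[OF subsetD[OF C(2) x(1)], of j] that by simp
        have "x j \<in> C" if "j < n" for j
          using *[of j] that by simp
        then show "x \<in> L"
          using x(2) unfolding L_def by (auto simp: PiE_def)
      qed
    qed
  qed
  also have "\<dots> < \<infinity>" by (rule LP)
  finally show "emeasure (diagonal_distr i) K < \<infinity>" .
qed

lemma integral_diagonal_distr:
  fixes f :: "(nat \<Rightarrow> 'a) \<Rightarrow> 'f::{real_normed_field,euclidean_space}"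
  assumes "bounded_cs (power_top (Suc n)) f" "i < n"
  shows "integral\<^sup>L (diagonal_distr i) f = integral\<^sup>L P (pullback (Suc n) n (id(n := i)) f)"
proof -
  have "integral\<^sup>L (diagonal_distr i) f = (\<integral>x. f (x(n := x i)) \<partial>P)"
    unfolding diagonal_distr_def using assms
    by (intro integral_distr measurable_diagonal) (auto simp: bounded_cs_def)
  also have "\<dots> = integral\<^sup>L P (pullback (Suc n) n (id(n := i)) f)"
  proof (intro Bochner_Integration.integral_cong refl)
    fix x assume x: "x \<in> space P"
    have "restrict (x \<circ> id(n := i)) {..<Suc n} = x(n := x i)"
      using x nonneg_radon_space[OF P] by (auto simp: fun_eq_iff PiE_def extensional_def)
    then show "f (x(n := x i)) = pullback (Suc n) n (id(n := i)) f x"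
      using x nonneg_radon_space[OF P] by (simp add: pullback_def)
  qed
  finally show ?thesis .
qed

end

definition integrate_last ::
    "('a::topological_space set \<Rightarrow> 'f::{real_normed_field,euclidean_space}) \<Rightarrow> nat \<Rightarrow>
     ((nat \<Rightarrow> 'a) \<Rightarrow> 'f) \<Rightarrow> (nat \<Rightarrow> 'a) \<Rightarrow> 'f" where
  "integrate_last \<omega> n f x =
     (if x \<in> topspace (power_top n) then radon_integral euclidean \<omega> (\<lambda>y. f (x(n := y))) else 0)"

lemma integrate_last_representation:
  fixes \<omega> :: "'a::polish_space set \<Rightarrow> 'f::{real_normed_field,euclidean_space}"
  assumes "represents euclidean J c M \<omega>" "bounded_cs (power_top (Suc n)) f"
  shows "integrate_last \<omega> n f =
    (\<lambda>x. \<Sum>j\<in>J. c j * (if x \<in> topspace (power_top n) then \<integral>y. f (x(n := y)) \<partial>M j else 0))"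
  unfolding integrate_last_def fun_eq_iff
  using represents_radon_integral[OF _ assms(1) bounded_cs_section[OF assms(2)]] by simp

lemma bounded_cs_integrate_last:
  fixes \<omega> :: "'a::polish_space set \<Rightarrow> 'f::{real_normed_field,euclidean_space}"
  assumes lc: "locally_compact_space (euclidean :: 'a topology)"
    and \<omega>: "\<omega> \<in> radon_measures euclidean" and f: "bounded_cs (power_top (Suc n)) f"
  shows "bounded_cs (power_top n) (integrate_last \<omega> n f)"
proof -
  obtain c M where r: "represents euclidean ((Basis :: 'f set) \<times> (UNIV::bool set)) c M \<omega>"
    using \<omega> by (rule radon_measures_represents)
  have M: "nonneg_radon euclidean (M j)" if "j \<in> (Basis :: 'f set) \<times> (UNIV::bool set)" for j
    using r that unfolding represents_def by blast
  show ?thesis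
    unfolding integrate_last_representation[OF r f]
    by (intro bounded_cs_sum bounded_cs_mult_left bounded_cs_integral_last[OF lc M f])
qed

lemma image_diagonal: "i < n \<Longrightarrow> id(n := i) ` {..<Suc n} = {..<n}"
  by (auto simp: image_iff less_Suc_eq)

text \<open>The integration against the kernel \<open>\<omega> - \<Sum>\<^sub>i\<^sub>\<in>\<^sub>D \<delta>\<^sub>x\<^sub>i\<close>: \<open>D = {}\<close> gives the tensor powers and
  \<open>D = {..<n}\<close> the falling powers.\<close>

definition diagonal_step ::
    "('a::topological_space set \<Rightarrow> 'f::{real_normed_field,euclidean_space}) \<Rightarrow> nat set \<Rightarrow> nat \<Rightarrow>
     ((nat \<Rightarrow> 'a) \<Rightarrow> 'f) \<Rightarrow> (nat \<Rightarrow> 'a) \<Rightarrow> 'f" where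
  "diagonal_step \<omega> D n f x =
     integrate_last \<omega> n f x - (\<Sum>i\<in>D. pullback (Suc n) n (id(n := i)) f x)"

lemma bounded_cs_diagonal_step:
  fixes \<omega> :: "'a::polish_space set \<Rightarrow> 'f::{real_normed_field,euclidean_space}"
  assumes lc: "locally_compact_space (euclidean :: 'a topology)"
    and \<omega>: "\<omega> \<in> radon_measures euclidean" and D: "D \<subseteq> {..<n}" and f: "bounded_cs (power_top (Suc n)) f"
  shows "bounded_cs (power_top n) (diagonal_step \<omega> D n f)"
  unfolding diagonal_step_def[abs_def] using D
  by (intro bounded_cs_diff bounded_cs_sum bounded_cs_pullback bounded_cs_integrate_last[OF lc \<omega> f] f image_diagonal)
     auto

text \<open>A scalar-valued Radon measure has the default value 0 off the precompact sets, so the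
  kernel assigns the intended mass to a section only because the section is precompact.\<close>

lemma section_precompact:
  fixes A :: "(nat \<Rightarrow> 'a::polish_space) set"
  assumes A: "A \<in> precompact_sets (power_top (Suc n))" and x: "x \<in> topspace (power_top n)"
  shows "{y. x(n := y) \<in> A} \<in> precompact_sets euclidean"
proof -
  have "bounded_cs euclidean (\<lambda>y. indicator A (x(n := y)) :: real)"
    by (intro bounded_cs_section bounded_cs_indicator A x)
  then obtain K where K: "(\<lambda>y. indicator A (x(n := y)) :: real) \<in> borel_measurable (borel_of euclidean)"
      "compact K" "\<And>y. y \<notin> K \<Longrightarrow> (indicator A (x(n := y)) :: real) = 0"
    unfolding bounded_cs_def by auto
  have "(\<lambda>y. indicator A (x(n := y)) :: real) -` {1} \<inter> space (borel_of euclidean) \<in> sets (borel_of euclidean)"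
    using K(1) by (rule measurable_sets) simp
  moreover have "(\<lambda>y. indicator A (x(n := y)) :: real) -` {1} \<inter> space (borel_of euclidean) = {y. x(n := y) \<in> A}"
    by (auto simp: indicator_def)
  ultimately show ?thesis
    using K(2,3) by (intro precompact_setsI[of _ K]) (auto simp: indicator_def split: if_splits)
qed

text \<open>Expanding \<nu> and \<omega> into nonnegative components turns the kernel product into
  product measures and diagonal images. Computing the integrals against these first also settles the
  set function, since the kernel evaluated at a section is \<open>diagonal_step\<close> applied to
  an indicator.\<close>

lemma
  fixes \<omega> :: "'a::polish_space set \<Rightarrow> 'f::{real_normed_field,euclidean_space}"
  assumes lc: "locally_compact_space (euclidean :: 'a topology)"
    and \<nu>: "\<nu> \<in> radon_measures (power_top n)" and \<omega>: "\<omega> \<in> radon_measures euclidean"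
    and D: "D \<subseteq> {..<n}"
  defines "\<kappa> \<equiv> \<lambda>x A. \<omega> A - (\<Sum>i\<in>D. dirac euclidean (x i) A)"
  shows kernel_product_radon: "kernel_product n \<nu> \<kappa> \<in> radon_measures (power_top (Suc n))"
    and pairing_kernel_product: "bounded_cs (power_top (Suc n)) f \<Longrightarrow>
      pairing (Suc n) (kernel_product n \<nu> \<kappa>) f = pairing n \<nu> (diagonal_step \<omega> D n f)"
proof -
  let ?I = "(Basis :: 'f set) \<times> (UNIV::bool set)"
  obtain c M where r: "represents (power_top n) ?I c M \<nu>"
    using \<nu> by (rule radon_measures_represents)
  obtain c' M' where r': "represents euclidean ?I c' M' \<omega>"
    using \<omega> by (rule radon_measures_represents)
  have M: "nonneg_radon (power_top n) (M j)" and M': "nonneg_radon euclidean (M' j)" if "j \<in> ?I" for j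
    using r r' that unfolding represents_def by blast+
  have D': "finite D" "\<And>i. i \<in> D \<Longrightarrow> i < n"
    using D finite_subset by auto
  \<comment> \<open>The left summand indexes the products of a component of \<omega> with one of
    \<nu>. The right one indexes the diagonal images, with the minus sign of the kernel placed in
    the coefficient.\<close>
  define J where "J = (?I \<times> ?I) <+> (D \<times> ?I)"
  define d where "d = case_sum (\<lambda>(j', j). c j * c' j') (\<lambda>(i :: nat, j). - c j)"
  define N where "N = case_sum (\<lambda>(j', j). product_distr n (M j) (M' j')) (\<lambda>(i, j). diagonal_distr n (M j) i)"
  have finJ: "finite J"
    unfolding J_def using D' by (intro finite_Plus finite_cartesian_product) auto
  have N: "nonneg_radon (power_top (Suc n)) (N j)" if "j \<in> J" for j
    using that M M' D'(2) unfolding J_def N_def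
    by (auto intro!: nonneg_radon_product_distr[OF lc] nonneg_radon_diagonal_distr)
  have eval: "(\<Sum>j\<in>J. d j * integral\<^sup>L (N j) f) = pairing n \<nu> (diagonal_step \<omega> D n f)"
    if f: "bounded_cs (power_top (Suc n)) f" for f
  proof -
    let ?h = "\<lambda>j' x. if x \<in> topspace (power_top n) then \<integral>y. f (x(n := y)) \<partial>M' j' else 0"
    have h: "bounded_cs (power_top n) (?h j')" if "j' \<in> ?I" for j'
      by (rule bounded_cs_integral_last[OF lc M'[OF that] f])
    have p: "bounded_cs (power_top n) (pullback (Suc n) n (id(n := i)) f)" if "i \<in> D" for i
      using D' that by (intro bounded_cs_pullback f image_diagonal)
    have \<nu>_eval: "pairing n \<nu> g = (\<Sum>j\<in>?I. c j * integral\<^sup>L (M j) g)" if "bounded_cs (power_top n) g" for g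
      unfolding pairing_def by (rule represents_radon_integral[OF Hausdorff_power_top r that])
    have h_int: "integral\<^sup>L (M j) (?h j') = integral\<^sup>L (product_distr n (M j) (M' j')) f"
      if "j \<in> ?I" "j' \<in> ?I" for j j'
      unfolding integral_product_distr[OF lc M[OF that(1)] M'[OF that(2)] f]
      by (intro Bochner_Integration.integral_cong) (auto simp: nonneg_radon_space[OF M[OF that(1)]])
    have "pairing n \<nu> (integrate_last \<omega> n f) = (\<Sum>j'\<in>?I. c' j' * pairing n \<nu> (?h j'))"
      unfolding integrate_last_representation[OF r' f] pairing_def
      by (simp only: radon_integral_sum radon_integral_mult_left Hausdorff_power_top \<nu> bounded_cs_mult_left h
          cong: sum.cong)
    also have "\<dots> = (\<Sum>j'\<in>?I. \<Sum>j\<in>?I. c j * c' j' * integral\<^sup>L (product_distr n (M j) (M' j')) f)"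
    proof (rule sum.cong[OF refl])
      fix j' assume j': "j' \<in> ?I"
      show "c' j' * pairing n \<nu> (?h j') = (\<Sum>j\<in>?I. c j * c' j' * integral\<^sup>L (product_distr n (M j) (M' j')) f)"
        unfolding \<nu>_eval[OF h[OF j']] sum_distrib_left
        by (intro sum.cong refl) (simp only: h_int j' mult_ac)
    qed
    finally have 1: "pairing n \<nu> (integrate_last \<omega> n f) = \<dots>" .
    have "pairing n \<nu> (\<lambda>x. \<Sum>i\<in>D. pullback (Suc n) n (id(n := i)) f x) =
        (\<Sum>i\<in>D. pairing n \<nu> (pullback (Suc n) n (id(n := i)) f))"
      unfolding pairing_def by (intro radon_integral_sum Hausdorff_power_top \<nu> p)
    also have "\<dots> = (\<Sum>i\<in>D. \<Sum>j\<in>?I. c j * integral\<^sup>L (diagonal_distr n (M j) i) f)"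
      by (intro sum.cong refl) (simp add: \<nu>_eval[OF p] integral_diagonal_distr[OF M f D'(2)])
    finally have 2: "pairing n \<nu> (\<lambda>x. \<Sum>i\<in>D. pullback (Suc n) n (id(n := i)) f x) = \<dots>" .
    have "pairing n \<nu> (diagonal_step \<omega> D n f) =
       (\<Sum>j'\<in>?I. \<Sum>j\<in>?I. c j * c' j' * integral\<^sup>L (product_distr n (M j) (M' j')) f) -
       (\<Sum>i\<in>D. \<Sum>j\<in>?I. c j * integral\<^sup>L (diagonal_distr n (M j) i) f)"
      unfolding diagonal_step_def[abs_def] 1[symmetric] 2[symmetric] pairing_def
      by (subst radon_integral_diff[OF Hausdorff_power_top \<nu> bounded_cs_integrate_last[OF lc \<omega> f]])
         (auto intro: bounded_cs_sum p)
    then show ?thesis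
      unfolding J_def d_def N_def using D'
      by (simp add: sum.Plus finite_cartesian_product sum.cartesian_product' sum_negf del: UNIV_Times_UNIV)
  qed
  have "represents (power_top (Suc n)) J d N (kernel_product n \<nu> \<kappa>)"
    unfolding represents_def
  proof (intro conjI ballI allI finJ N)
    fix A :: "(nat \<Rightarrow> 'a) set"
    have "kernel_product n \<nu> \<kappa> A = (\<Sum>j\<in>J. measure (N j) A *\<^sub>R d j)"
      if A: "A \<in> precompact_sets (power_top (Suc n))"
    proof -
      have "(if x \<in> topspace (power_top n) then \<kappa> x {y. x(n := y) \<in> A} else 0) =
          diagonal_step \<omega> D n (indicator A) x" for x
      proof (cases "x \<in> topspace (power_top n)")
        case True
        have s: "{y. x(n := y) \<in> A} \<in> precompact_sets euclidean"
          by (rule section_precompact[OF A True])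
        have i: "(indicator {y. x(n := y) \<in> A} :: 'a \<Rightarrow> 'f) = (\<lambda>y. indicator A (x(n := y)))"
          by (auto simp: indicator_def fun_eq_iff)
        have 1: "\<omega> {y. x(n := y) \<in> A} = integrate_last \<omega> n (indicator A) x"
          unfolding integrate_last_def if_P[OF True] i[symmetric]
          by (rule radon_integral_indicator[OF Hausdorff_space_euclidean \<omega> s, symmetric])
        have "dirac euclidean (x i) {y. x(n := y) \<in> A} = (pullback (Suc n) n (id(n := i)) (indicator A) x :: 'f)"
          if "i \<in> D" for i
        proof -
          have "restrict (x \<circ> id(n := i)) {..<Suc n} = x(n := x i)"
            using True by (auto simp: fun_eq_iff PiE_def extensional_def)
          then show ?thesis
            using True s by (simp add: dirac_def pullback_def indicator_def)
        qed
        then show ?thesis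
          using True 1 by (simp add: \<kappa>_def diagonal_step_def)
      qed (simp add: diagonal_step_def integrate_last_def pullback_def)
      then have "kernel_product n \<nu> \<kappa> A = pairing n \<nu> (diagonal_step \<omega> D n (indicator A))"
        using A by (simp only: kernel_product_def pairing_def if_True)
      also have "\<dots> = (\<Sum>j\<in>J. d j * integral\<^sup>L (N j) (indicator A))"
        by (rule eval[OF bounded_cs_indicator[OF A], symmetric])
      also have "\<dots> = (\<Sum>j\<in>J. measure (N j) A *\<^sub>R d j)"
        by (rule represents_indicator[OF Hausdorff_power_top N A])
      finally show ?thesis .
    qed
    then show "kernel_product n \<nu> \<kappa> A =
        (if A \<in> precompact_sets (power_top (Suc n)) then \<Sum>j\<in>J. measure (N j) A *\<^sub>R d j else 0)"
      by (simp add: kernel_product_def)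
  qed
  note rep = this
  show "kernel_product n \<nu> \<kappa> \<in> radon_measures (power_top (Suc n))"
    by (rule represents_radon_measures[OF Hausdorff_power_top rep])
  show "pairing (Suc n) (kernel_product n \<nu> \<kappa>) f = pairing n \<nu> (diagonal_step \<omega> D n f)"
    if f: "bounded_cs (power_top (Suc n)) f"
    using represents_radon_integral[OF Hausdorff_power_top rep f] eval[OF f]
    by (simp add: pairing_def)
qed

section \<open>Dirac measures and the zeroth powers\<close>

lemma represents_dirac:
  assumes x: "x \<in> topspace T" and T: "Hausdorff_space T"
  shows "represents T {()} (\<lambda>_. 1) (\<lambda>_. return (borel_of T) x) (dirac T x)"
  unfolding represents_def
proof (intro conjI ballI allI)
  show "nonneg_radon T (return (borel_of T) x)"
    using compactin_in_borel_of[OF T] by (auto simp: nonneg_radon_def indicator_def)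
  fix A
  show "dirac T x A = (if A \<in> precompact_sets T
      then \<Sum>j\<in>{()}. measure (return (borel_of T) x) A *\<^sub>R 1 else 0)"
    using precompact_setsD(1)[of A T] by (simp add: dirac_def measure_return)
qed simp

lemma radon_integral_dirac:
  assumes "x \<in> topspace T" "Hausdorff_space T" "bounded_cs T f"
  shows "radon_integral T (dirac T x) f = f x"
proof -
  have "f \<in> borel_measurable (borel_of T)"
    using assms(3) by (simp add: bounded_cs_def)
  then have "integral\<^sup>L (return (borel_of T) x) f = f x"
    using assms by (intro integral_return) auto
  then show ?thesis
    by (simp add: represents_radon_integral[OF assms(2) represents_dirac[OF assms(1,2)] assms(3)])
qed

lemma pairing_unit:
  fixes f :: "(nat \<Rightarrow> 'a::polish_space) \<Rightarrow> 'f::{real_normed_field,euclidean_space}"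
  shows "bounded_cs (power_top 0) f \<Longrightarrow> pairing 0 (dirac (power_top 0) (\<lambda>_. undefined)) f = f (\<lambda>_. undefined)"
  unfolding pairing_def by (rule radon_integral_dirac) (auto simp: PiE_def extensional_def)

lemma unit_radon:
  "(dirac (power_top 0) (\<lambda>_. undefined) :: (nat \<Rightarrow> 'a::polish_space) set \<Rightarrow> 'f::{real_normed_field,euclidean_space})
     \<in> radon_measures (power_top 0)"
  by (rule represents_radon_measures[OF Hausdorff_power_top represents_dirac]) (auto simp: PiE_def extensional_def)

section \<open>Recursions for the pairings with tensor and falling powers\<close>

context
  fixes \<omega> :: "'a::polish_space set \<Rightarrow> 'f::{real_normed_field,euclidean_space}"
  assumes lc: "locally_compact_space (euclidean :: 'a topology)"
    and \<omega>: "\<omega> \<in> radon_measures euclidean"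
begin

lemma falling_power_radon: "falling_power \<omega> n \<in> radon_measures (power_top n)"
  by (induction n) (simp_all add: unit_radon kernel_product_radon[OF lc _ \<omega> subset_refl])

lemma tensor_power_radon: "tensor_power \<omega> n \<in> radon_measures (power_top n)"
  using kernel_product_radon[OF lc _ \<omega>, of _ _ "{}"]
  by (induction n) (simp_all add: unit_radon)

lemma pairing_falling_power_Suc:
  "bounded_cs (power_top (Suc n)) f \<Longrightarrow>
     pairing (Suc n) (falling_power \<omega> (Suc n)) f = pairing n (falling_power \<omega> n) (diagonal_step \<omega> {..<n} n f)"
  using pairing_kernel_product[OF lc falling_power_radon \<omega> subset_refl] by simp

lemma pairing_tensor_power_Suc:
  "bounded_cs (power_top (Suc n)) f \<Longrightarrow>
     pairing (Suc n) (tensor_power \<omega> (Suc n)) f = pairing n (tensor_power \<omega> n) (integrate_last \<omega> n f)"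
  using pairing_kernel_product[OF lc tensor_power_radon \<omega> empty_subsetI, of n f]
  by (simp add: diagonal_step_def[abs_def])

end

section \<open>Symmetry of the falling powers\<close>

lemma restrict_in_power [simp]: "restrict x {..<n} \<in> topspace (power_top n)"
  by simp

lemma pullback_pullback:
  fixes f :: "(nat \<Rightarrow> 'a::topological_space) \<Rightarrow> 'f::zero"
  assumes "\<sigma> ` {..<n} \<subseteq> {..<m}"
  shows "pullback m k \<tau> (pullback n m \<sigma> f) = pullback n k (\<tau> \<circ> \<sigma>) f"
proof
  fix x :: "nat \<Rightarrow> 'a"
  have "restrict (restrict (x \<circ> \<tau>) {..<m} \<circ> \<sigma>) {..<n} = restrict (x \<circ> (\<tau> \<circ> \<sigma>)) {..<n}"
    using assms by (auto simp: fun_eq_iff)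
  then show "pullback m k \<tau> (pullback n m \<sigma> f) x = pullback n k (\<tau> \<circ> \<sigma>) f x"
    by (simp add: pullback_def)
qed

lemma pullback_cong:
  fixes f :: "(nat \<Rightarrow> 'a::topological_space) \<Rightarrow> 'f::zero"
  assumes "\<And>i. i < n \<Longrightarrow> \<sigma> i = \<tau> i"
  shows "pullback n k \<sigma> f = pullback n k \<tau> f"
proof
  fix x :: "nat \<Rightarrow> 'a"
  have "restrict (x \<circ> \<sigma>) {..<n} = restrict (x \<circ> \<tau>) {..<n}"
    using assms by (auto simp: fun_eq_iff)
  then show "pullback n k \<sigma> f x = pullback n k \<tau> f x"
    by (simp add: pullback_def)
qed

lemma pullback_permutes:
  assumes "\<pi> permutes {..<n}" "x \<in> topspace (power_top n)"
  shows "pullback n n \<pi> f x = f (x \<circ> \<pi>)"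
proof -
  have "restrict (x \<circ> \<pi>) {..<n} = x \<circ> \<pi>"
    using assms by (auto simp: fun_eq_iff PiE_def extensional_def permutes_def)
  then show ?thesis
    using assms by (simp add: pullback_def)
qed

lemma pullback_id:
  fixes f :: "(nat \<Rightarrow> 'a::polish_space) \<Rightarrow> 'f::{real_normed_field,euclidean_space}"
  assumes "bounded_cs (power_top n) f"
  shows "pullback n n id f = f"
  using bounded_cs_power_outside[OF assms]
  by (auto simp: pullback_def fun_eq_iff PiE_restrict)

text \<open>The map \<open>\<sigma>(n := k)\<close> keeps the integrated variable apart from all
  others, so renaming or merging the remaining variables does not interfere with the
  integration.\<close>

lemma pullback_integrate_last:
  assumes "\<sigma> ` {..<n} \<subseteq> {..<k}"
  shows "pullback n k \<sigma> (integrate_last \<omega> n f) = integrate_last \<omega> k (pullback (Suc n) (Suc k) (\<sigma>(n := k)) f)"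
proof
  fix x
  show "pullback n k \<sigma> (integrate_last \<omega> n f) x =
      integrate_last \<omega> k (pullback (Suc n) (Suc k) (\<sigma>(n := k)) f) x"
  proof (cases "x \<in> topspace (power_top k)")
    case True
    have "restrict (x(k := y) \<circ> \<sigma>(n := k)) {..<Suc n} = (restrict (x \<circ> \<sigma>) {..<n})(n := y)" for y
      using assms by (auto simp: fun_eq_iff less_Suc_eq)
    moreover have "x(k := y) \<in> topspace (power_top (Suc k))" for y
      using True by (auto simp: PiE_def extensional_def)
    ultimately show ?thesis
      using True by (simp add: pullback_def integrate_last_def)
  qed (simp add: pullback_def integrate_last_def)
qed

text \<open>A permutation of the first n coordinates leaves the integrated variable alone and
  carries the i-th subtracted diagonal to the one with index \<open>\<tau> i\<close>; the sum over
  all diagonals is therefore unchanged.\<close>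

lemma diagonal_step_pullback:
  assumes \<tau>: "\<tau> permutes {..<n}"
  shows "diagonal_step \<omega> {..<n} n (pullback (Suc n) (Suc n) \<tau> f) = pullback n n \<tau> (diagonal_step \<omega> {..<n} n f)"
proof -
  have im: "\<tau> ` {..<n} = {..<n}" "\<tau> ` {..<Suc n} \<subseteq> {..<Suc n}" "\<tau> n = n"
    using permutes_image[OF \<tau>] permutes_not_in[OF \<tau>, of n] by (auto simp: lessThan_Suc)
  have "pullback n n \<tau> (integrate_last \<omega> n f) = integrate_last \<omega> n (pullback (Suc n) (Suc n) (\<tau>(n := n)) f)"
    using im by (intro pullback_integrate_last) auto
  also have "\<tau>(n := n) = \<tau>"
    using im(3) by auto
  finally have 1: "pullback n n \<tau> (integrate_last \<omega> n f) = integrate_last \<omega> n (pullback (Suc n) (Suc n) \<tau> f)" .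
  have "pullback n n \<tau> (pullback (Suc n) n (id(n := i)) f) =
      pullback (Suc n) n (id(n := \<tau> i)) (pullback (Suc n) (Suc n) \<tau> f)" if i: "i < n" for i
  proof -
    have "(\<tau> \<circ> id(n := i)) j = (id(n := \<tau> i) \<circ> \<tau>) j" if "j < Suc n" for j
      using that im by (auto simp: less_Suc_eq)
    moreover have "id(n := i) ` {..<Suc n} \<subseteq> {..<n}"
      using image_diagonal[OF i] by simp
    ultimately show ?thesis
      using im by (simp add: pullback_pullback cong: pullback_cong)
  qed
  then have 2: "(\<Sum>i<n. pullback n n \<tau> (pullback (Suc n) n (id(n := i)) f) x) =
      (\<Sum>i<n. pullback (Suc n) n (id(n := i)) (pullback (Suc n) (Suc n) \<tau> f) x)" for x
    by (subst (2) sum.permute[OF \<tau>]) simp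
  show ?thesis
  proof
    fix x
    show "diagonal_step \<omega> {..<n} n (pullback (Suc n) (Suc n) \<tau> f) x = pullback n n \<tau> (diagonal_step \<omega> {..<n} n f) x"
      unfolding diagonal_step_def 1[symmetric] 2[symmetric] by (simp add: pullback_def diagonal_step_def)
  qed
qed

lemma pullback_transpose_last:
  assumes "x \<in> topspace (power_top n)"
  shows "pullback (Suc (Suc n)) (Suc (Suc n)) (Transposition.transpose n (Suc n)) f (x(n := y, Suc n := z)) = f (x(n := z, Suc n := y))"
proof -
  have "restrict (x(n := y, Suc n := z) \<circ> Transposition.transpose n (Suc n)) {..<Suc (Suc n)} = x(n := z, Suc n := y)"
    using assms by (auto simp: fun_eq_iff PiE_def extensional_def Transposition.transpose_def)
  moreover have "x(n := y, Suc n := z) \<in> topspace (power_top (Suc (Suc n)))"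
    using assms by (auto simp: PiE_def extensional_def)
  ultimately show ?thesis by (simp add: pullback_def)
qed

section \<open>Exchanging the last two integrations\<close>

lemma bounded_cs_section2:
  fixes f :: "(nat \<Rightarrow> 'a::polish_space) \<Rightarrow> 'f::{real_normed_field,euclidean_space}"
  assumes f: "bounded_cs (power_top (Suc (Suc n))) f" and x: "x \<in> topspace (power_top n)"
  shows "bounded_cs euclidean (\<lambda>z. f (x(n := y, Suc n := z)))"
    and "bounded_cs euclidean (\<lambda>y. f (x(n := y, Suc n := z)))"
    and "bounded_cs euclidean (\<lambda>y. f (x(n := y, Suc n := y)))"
proof -
  have x': "x(n := y) \<in> topspace (power_top (Suc n))" for y
    using x by (auto simp: PiE_def extensional_def)
  show "bounded_cs euclidean (\<lambda>z. f (x(n := y, Suc n := z)))"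
    by (rule bounded_cs_section[OF f x'])
  have "bounded_cs (power_top (Suc (Suc n))) (pullback (Suc (Suc n)) (Suc (Suc n)) (Transposition.transpose n (Suc n)) f)"
    by (intro bounded_cs_pullback f permutes_image permutes_swap_id) auto
  from bounded_cs_section[OF this x']
  show "bounded_cs euclidean (\<lambda>y. f (x(n := y, Suc n := z)))"
    by (simp add: pullback_transpose_last[OF x])
  have "bounded_cs (power_top (Suc n)) (pullback (Suc (Suc n)) (Suc n) (id(Suc n := n)) f)"
    by (intro bounded_cs_pullback f image_diagonal) simp
  from bounded_cs_section[OF this x]
  have "bounded_cs euclidean (\<lambda>y. pullback (Suc (Suc n)) (Suc n) (id(Suc n := n)) f (x(n := y)))" .
  moreover have "pullback (Suc (Suc n)) (Suc n) (id(Suc n := n)) f (x(n := y)) = f (x(n := y, Suc n := y))" for y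
  proof -
    have "restrict (x(n := y) \<circ> id(Suc n := n)) {..<Suc (Suc n)} = x(n := y, Suc n := y)"
      using x by (auto simp: fun_eq_iff PiE_def extensional_def)
    then show ?thesis using x' by (simp add: pullback_def)
  qed
  ultimately show "bounded_cs euclidean (\<lambda>y. f (x(n := y, Suc n := y)))"
    by simp
qed

lemma bounded_cs_partial_integral:
  fixes f :: "(nat \<Rightarrow> 'a::polish_space) \<Rightarrow> 'f::{real_normed_field,euclidean_space}"
  assumes lc: "locally_compact_space (euclidean :: 'a topology)" and Q: "nonneg_radon euclidean Q"
    and f: "bounded_cs (power_top (Suc (Suc n))) f" and x: "x \<in> topspace (power_top n)"
  shows "bounded_cs euclidean (\<lambda>y. \<integral>z. f (x(n := y, Suc n := z)) \<partial>Q)"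
    and "bounded_cs euclidean (\<lambda>y. \<integral>z. f (x(n := z, Suc n := y)) \<partial>Q)"
proof -
  have x': "x(n := y) \<in> topspace (power_top (Suc n))" for y
    using x by (auto simp: PiE_def extensional_def)
  have *: "bounded_cs euclidean (\<lambda>y. \<integral>z. g (x(n := y, Suc n := z)) \<partial>Q)"
    if g: "bounded_cs (power_top (Suc (Suc n))) g" for g :: "(nat \<Rightarrow> 'a) \<Rightarrow> 'f"
    using bounded_cs_section[OF bounded_cs_integral_last[OF lc Q g] x] x' by simp
  show "bounded_cs euclidean (\<lambda>y. \<integral>z. f (x(n := y, Suc n := z)) \<partial>Q)"
    by (rule *[OF f])
  have "bounded_cs (power_top (Suc (Suc n))) (pullback (Suc (Suc n)) (Suc (Suc n)) (Transposition.transpose n (Suc n)) f)"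
    by (intro bounded_cs_pullback f permutes_image permutes_swap_id) auto
  from *[OF this] show "bounded_cs euclidean (\<lambda>y. \<integral>z. f (x(n := z, Suc n := y)) \<partial>Q)"
    by (simp add: pullback_transpose_last[OF x])
qed

text \<open>Joint integrability comes from the bound B and from the support of f in the last two
  variables, which lies in \<open>C \<times> C\<close>, a set of finite product mass.\<close>

lemma nonneg_radon_Fubini:
  fixes f :: "(nat \<Rightarrow> 'a::polish_space) \<Rightarrow> 'f::{real_normed_field,euclidean_space}"
  assumes lc: "locally_compact_space (euclidean :: 'a topology)"
    and P: "nonneg_radon euclidean P" and Q: "nonneg_radon euclidean Q"
    and f: "bounded_cs (power_top (Suc (Suc n))) f" and x: "x \<in> topspace (power_top n)"
  shows "(\<integral>y. (\<integral>z. f (x(n := y, Suc n := z)) \<partial>Q) \<partial>P) = (\<integral>z. (\<integral>y. f (x(n := y, Suc n := z)) \<partial>P) \<partial>Q)"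
proof -
  interpret pair_sigma_finite P Q
    using sigma_finite_nonneg_radon[OF lc] P Q by (simp add: pair_sigma_finite_def)
  obtain B C where *: "f \<in> borel_measurable (power_algebra (Suc (Suc n)))" "\<And>x. norm (f x) \<le> B" "B \<ge> 0"
    "compact C" "\<And>x. x \<notin> (\<Pi>\<^sub>E i\<in>{..<Suc (Suc n)}. C) \<Longrightarrow> f x = 0"
    using f by (rule bounded_cs_powerE) blast
  have C: "C \<in> sets P" "C \<in> sets Q" "emeasure P C < \<infinity>" "emeasure Q C < \<infinity>"
    using * P Q by (auto simp: nonneg_radon_def borel_compact)
  have "(\<lambda>p. x(n := fst p, Suc n := snd p)) \<in> measurable (borel \<Otimes>\<^sub>M borel) (power_algebra (Suc (Suc n)) :: (nat \<Rightarrow> 'a) measure)"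
  proof (rule measurable_PiM_single')
    fix i
    show "(\<lambda>p. (x(n := fst p, Suc n := snd p)) i) \<in> measurable (borel \<Otimes>\<^sub>M borel) borel"
      by (cases "i = Suc n"; cases "i = n") simp_all
  qed (use x in \<open>auto simp: PiE_def extensional_def\<close>)
  from measurable_compose[OF this *(1)]
  have "(\<lambda>p. f (x(n := fst p, Suc n := snd p))) \<in> borel_measurable (borel \<Otimes>\<^sub>M borel)" .
  moreover have "sets (P \<Otimes>\<^sub>M Q) = sets (borel \<Otimes>\<^sub>M borel)"
    using P Q by (intro sets_pair_measure_cong) (auto simp: nonneg_radon_def)
  ultimately have meas: "(\<lambda>p. f (x(n := fst p, Suc n := snd p))) \<in> borel_measurable (P \<Otimes>\<^sub>M Q)"
    using measurable_cong_sets by blast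
  have "integrable (P \<Otimes>\<^sub>M Q) (\<lambda>p. f (x(n := fst p, Suc n := snd p)))"
  proof (rule Bochner_Integration.integrable_bound[OF _ meas])
    have "emeasure (P \<Otimes>\<^sub>M Q) (C \<times> C) < \<infinity>"
      using C by (simp add: M2.emeasure_pair_measure_Times ennreal_mult_less_top)
    then show "integrable (P \<Otimes>\<^sub>M Q) (\<lambda>p. B * indicator (C \<times> C) p :: real)"
      using C by (intro integrable_mult_right integrable_real_indicator) auto
    show "AE p in P \<Otimes>\<^sub>M Q. norm (f (x(n := fst p, Suc n := snd p))) \<le> norm (B * indicator (C \<times> C) p :: real)"
    proof (intro AE_I2)
      fix p :: "'a \<times> 'a"
      have "f (x(n := fst p, Suc n := snd p)) = 0" if "p \<notin> C \<times> C"
      proof (rule *(5), rule notI)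
        assume a: "x(n := fst p, Suc n := snd p) \<in> (\<Pi>\<^sub>E i\<in>{..<Suc (Suc n)}. C)"
        show False
          using PiE_mem[OF a, of n] PiE_mem[OF a, of "Suc n"] that by (auto simp: mem_Times_iff)
      qed
      then show "norm (f (x(n := fst p, Suc n := snd p))) \<le> norm (B * indicator (C \<times> C) p :: real)"
        using *(2,3) by (auto simp: indicator_def)
    qed
  qed
  then have "integrable (P \<Otimes>\<^sub>M Q) (case_prod (\<lambda>y z. f (x(n := y, Suc n := z))))"
    by (simp add: case_prod_unfold)
  from Fubini_integral[OF this] show ?thesis by simp
qed

text \<open>Both iterated integrals become double sums over the same pairs of components of
  \<omega>. Exchanging the order for one pair (j, j') produces the term of (j', j), and
  interchanging the two sums absorbs this.\<close>

lemma radon_integral_Fubini: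
  fixes \<omega> :: "'a::polish_space set \<Rightarrow> 'f::{real_normed_field,euclidean_space}"
  assumes lc: "locally_compact_space (euclidean :: 'a topology)" and \<omega>: "\<omega> \<in> radon_measures euclidean"
    and f: "bounded_cs (power_top (Suc (Suc n))) f" and x: "x \<in> topspace (power_top n)"
  shows "radon_integral euclidean \<omega> (\<lambda>y. radon_integral euclidean \<omega> (\<lambda>z. f (x(n := y, Suc n := z)))) =
    radon_integral euclidean \<omega> (\<lambda>y. radon_integral euclidean \<omega> (\<lambda>z. f (x(n := z, Suc n := y))))"
proof -
  let ?I = "(Basis :: 'f set) \<times> (UNIV::bool set)"
  obtain c M where r: "represents euclidean ?I c M \<omega>"
    using \<omega> by (rule radon_measures_represents)
  have M: "nonneg_radon euclidean (M j)" if "j \<in> ?I" for j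
    using r that unfolding represents_def by blast
  have eval: "radon_integral euclidean \<omega> g = (\<Sum>j\<in>?I. c j * integral\<^sup>L (M j) g)" if "bounded_cs euclidean g" for g
    by (rule represents_radon_integral[OF Hausdorff_space_euclidean r that])
  note sec = bounded_cs_section2(1,2)[OF f x]
  note par = bounded_cs_partial_integral[OF lc M f x]
  have double: "radon_integral euclidean \<omega> (\<lambda>y. radon_integral euclidean \<omega> (g y)) =
      (\<Sum>j\<in>?I. \<Sum>j'\<in>?I. c j * c j' * (\<integral>y. (\<integral>z. g y z \<partial>M j) \<partial>M j'))"
    if "\<And>y. bounded_cs euclidean (g y)" "\<And>j. j \<in> ?I \<Longrightarrow> bounded_cs euclidean (\<lambda>y. \<integral>z. g y z \<partial>M j)" for g
  proof -
    have "radon_integral euclidean \<omega> (\<lambda>y. radon_integral euclidean \<omega> (g y)) =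
        radon_integral euclidean \<omega> (\<lambda>y. \<Sum>j\<in>?I. c j * (\<integral>z. g y z \<partial>M j))"
      by (simp only: eval[OF that(1)])
    also have "\<dots> = (\<Sum>j\<in>?I. c j * radon_integral euclidean \<omega> (\<lambda>y. \<integral>z. g y z \<partial>M j))"
      by (simp only: radon_integral_sum radon_integral_mult_left Hausdorff_space_euclidean \<omega> bounded_cs_mult_left that(2)
          cong: sum.cong)
    also have "\<dots> = (\<Sum>j\<in>?I. \<Sum>j'\<in>?I. c j * c j' * (\<integral>y. (\<integral>z. g y z \<partial>M j) \<partial>M j'))"
      by (intro sum.cong refl) (simp add: eval[OF that(2)] sum_distrib_left mult.assoc)
    finally show ?thesis .
  qed
  have "radon_integral euclidean \<omega> (\<lambda>y. radon_integral euclidean \<omega> (\<lambda>z. f (x(n := y, Suc n := z)))) =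
     (\<Sum>j\<in>?I. \<Sum>j'\<in>?I. c j * c j' * (\<integral>y. (\<integral>z. f (x(n := y, Suc n := z)) \<partial>M j) \<partial>M j'))"
    by (rule double[OF sec(1) par(1)])
  also have "\<dots> = (\<Sum>j\<in>?I. \<Sum>j'\<in>?I. c j * c j' * (\<integral>z. (\<integral>y. f (x(n := y, Suc n := z)) \<partial>M j') \<partial>M j))"
    by (intro sum.cong refl) (simp only: nonneg_radon_Fubini[OF lc M M f x])
  also have "\<dots> = (\<Sum>j\<in>?I. \<Sum>j'\<in>?I. c j * c j' * (\<integral>z. (\<integral>y. f (x(n := y, Suc n := z)) \<partial>M j) \<partial>M j'))"
    by (subst sum.swap) (simp only: mult.commute)
  also have "\<dots> = radon_integral euclidean \<omega> (\<lambda>y. radon_integral euclidean \<omega> (\<lambda>z. f (x(n := z, Suc n := y))))"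
    by (rule double[OF sec(2) par(2), symmetric])
  finally show ?thesis .
qed

lemma permutes_lessThan_fix_last:
  assumes "\<tau> permutes {..<Suc m}" "\<tau> m = m"
  shows "\<tau> permutes {..<m}"
  using assms(1)
proof (rule permutes_superset)
  fix x assume "x \<in> {..<Suc m} - {..<m}"
  then have "x = m" by auto
  then show "\<tau> x = x" using assms(2) by simp
qed

lemma diagonal_step_apply:
  fixes \<omega> :: "'a::topological_space set \<Rightarrow> 'f::{real_normed_field,euclidean_space}"
  assumes "x \<in> topspace (power_top n)"
  shows "diagonal_step \<omega> {..<n} n f x =
    radon_integral euclidean \<omega> (\<lambda>y. f (x(n := y))) - (\<Sum>i<n. f (x(n := x i)))"
proof -
  have "restrict (x \<circ> id(n := i)) {..<Suc n} = x(n := x i)" for i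
    using assms by (auto simp: fun_eq_iff PiE_def extensional_def)
  then show ?thesis
    using assms by (simp add: diagonal_step_def integrate_last_def pullback_def)
qed

section \<open>Invariance of the falling powers under permutations\<close>

context
  fixes \<omega> :: "'a::polish_space set \<Rightarrow> 'f::{real_normed_field,euclidean_space}"
  assumes lc: "locally_compact_space (euclidean :: 'a topology)"
    and \<omega>: "\<omega> \<in> radon_measures euclidean"
begin

text \<open>Expanded in order to exhibit the symmetry in the two arguments of g. Each term is
  invariant or comes with its mirror image, apart from the iterated integral, which needs Fubini,
  and the double sum over i and j, which needs an interchange of sums.\<close>

lemma diagonal_step_twice:
  assumes f: "bounded_cs (power_top (Suc (Suc n))) f" and x: "x \<in> topspace (power_top n)"
  defines "g \<equiv> \<lambda>y z. f (x(n := y, Suc n := z))"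
  shows "diagonal_step \<omega> {..<n} n (diagonal_step \<omega> {..<Suc n} (Suc n) f) x =
    radon_integral euclidean \<omega> (\<lambda>y. radon_integral euclidean \<omega> (g y))
    - (\<Sum>i<n. radon_integral euclidean \<omega> (\<lambda>y. g y (x i)) + radon_integral euclidean \<omega> (g (x i)))
    - radon_integral euclidean \<omega> (\<lambda>y. g y y)
    + (\<Sum>i<n. (\<Sum>j<n. g (x i) (x j)) + g (x i) (x i))"
proof -
  have x': "x(n := y) \<in> topspace (power_top (Suc n))" for y
    using x by (auto simp: PiE_def extensional_def)
  have inner: "diagonal_step \<omega> {..<Suc n} (Suc n) f (x(n := y)) =
      radon_integral euclidean \<omega> (g y) - ((\<Sum>j<n. g y (x j)) + g y y)" for y
    unfolding diagonal_step_apply[OF x'] by (simp add: g_def)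
  have sec: "bounded_cs euclidean (g y)" "bounded_cs euclidean (\<lambda>y. g y z)" "bounded_cs euclidean (\<lambda>y. g y y)" for y z
    using bounded_cs_section2[OF f x] by (simp_all add: g_def)
  have "integrate_last \<omega> (Suc n) f (x(n := y)) = radon_integral euclidean \<omega> (g y)" for y
    using x' by (simp add: integrate_last_def g_def)
  then have int: "bounded_cs euclidean (\<lambda>y. radon_integral euclidean \<omega> (g y))"
    using bounded_cs_section[OF bounded_cs_integrate_last[OF lc \<omega> f] x] by simp
  have "radon_integral euclidean \<omega> (\<lambda>y. radon_integral euclidean \<omega> (g y) - ((\<Sum>j<n. g y (x j)) + g y y)) =
      radon_integral euclidean \<omega> (\<lambda>y. radon_integral euclidean \<omega> (g y))
      - ((\<Sum>j<n. radon_integral euclidean \<omega> (\<lambda>y. g y (x j))) + radon_integral euclidean \<omega> (\<lambda>y. g y y))"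
  proof -
    have sum: "bounded_cs euclidean (\<lambda>y. \<Sum>j<n. g y (x j))"
      by (intro bounded_cs_sum sec)
    show ?thesis
      by (subst radon_integral_diff[OF Hausdorff_space_euclidean \<omega> int bounded_cs_add[OF sum sec(3)]],
          subst radon_integral_add[OF Hausdorff_space_euclidean \<omega> sum sec(3)],
          subst radon_integral_sum[OF Hausdorff_space_euclidean \<omega> sec(2)]) (rule refl)
  qed
  then show ?thesis
    unfolding diagonal_step_apply[OF x] inner by (simp add: sum.distrib sum_subtractf algebra_simps)
qed

lemma diagonal_step_twice_transpose:
  assumes f: "bounded_cs (power_top (Suc (Suc n))) f"
  shows "diagonal_step \<omega> {..<n} n (diagonal_step \<omega> {..<Suc n} (Suc n)
      (pullback (Suc (Suc n)) (Suc (Suc n)) (Transposition.transpose n (Suc n)) f)) =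
    diagonal_step \<omega> {..<n} n (diagonal_step \<omega> {..<Suc n} (Suc n) f)"
proof
  fix x
  have f': "bounded_cs (power_top (Suc (Suc n))) (pullback (Suc (Suc n)) (Suc (Suc n)) (Transposition.transpose n (Suc n)) f)"
    by (intro bounded_cs_pullback f permutes_image permutes_swap_id) auto
  show "diagonal_step \<omega> {..<n} n (diagonal_step \<omega> {..<Suc n} (Suc n)
      (pullback (Suc (Suc n)) (Suc (Suc n)) (Transposition.transpose n (Suc n)) f)) x =
    diagonal_step \<omega> {..<n} n (diagonal_step \<omega> {..<Suc n} (Suc n) f) x"
  proof (cases "x \<in> topspace (power_top n)")
    case True
    have "(\<Sum>i<n. \<Sum>j<n. f (x(n := x j, Suc n := x i))) = (\<Sum>i<n. \<Sum>j<n. f (x(n := x i, Suc n := x j)))"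
      by (rule sum.swap)
    then show ?thesis
      unfolding diagonal_step_twice[OF f True] diagonal_step_twice[OF f' True] pullback_transpose_last[OF True]
        radon_integral_Fubini[OF lc \<omega> f True]
      by (simp add: sum.distrib)
  qed (simp add: diagonal_step_def integrate_last_def pullback_def)
qed

text \<open>Permutations fixing the last coordinate are handled by induction. Together with the transposition
  of the last two coordinates, under which integrating both out is invariant, they generate.\<close>

lemma pairing_falling_power_permutes:
  assumes "\<tau> permutes {..<n}" "bounded_cs (power_top n) f"
  shows "pairing n (falling_power \<omega> n) (pullback n n \<tau> f) = pairing n (falling_power \<omega> n) f"
  using assms
proof (induction n arbitrary: \<tau> f rule: less_induct)
  case (less n)
  have fix_last: "pairing n (falling_power \<omega> n) (pullback n n \<tau> f) = pairing n (falling_power \<omega> n) f"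
    if n: "n = Suc m" and \<tau>: "\<tau> permutes {..<m}" and f: "bounded_cs (power_top n) f" for m \<tau> f
  proof -
    have "\<tau> permutes {..<Suc m}"
      using \<tau> by (rule permutes_subset) auto
    then have "bounded_cs (power_top (Suc m)) (pullback (Suc m) (Suc m) \<tau> f)"
      using f n by (intro bounded_cs_pullback permutes_image) auto
    then have "pairing n (falling_power \<omega> n) (pullback n n \<tau> f) =
        pairing m (falling_power \<omega> m) (pullback m m \<tau> (diagonal_step \<omega> {..<m} m f))"
      using n diagonal_step_pullback[OF \<tau>, of \<omega> f] pairing_falling_power_Suc[OF lc \<omega>] by simp
    also have "\<dots> = pairing m (falling_power \<omega> m) (diagonal_step \<omega> {..<m} m f)"
      using n f by (intro less.IH \<tau> bounded_cs_diagonal_step[OF lc \<omega>]) auto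
    finally show ?thesis
      using n f pairing_falling_power_Suc[OF lc \<omega>] by simp
  qed
  show ?case
  proof (cases n)
    case 0
    then show ?thesis
      using less.prems pullback_id[OF less.prems(2)] by (simp add: id_def)
  next
    case (Suc m)
    show ?thesis
    proof (cases "\<tau> m = m")
      case True
      have "\<tau> permutes {..<m}"
        using less.prems(1) True unfolding Suc by (rule permutes_lessThan_fix_last)
      then show ?thesis
        by (rule fix_last[OF Suc _ less.prems(2)])
    next
      case False
      define j where "j = \<tau> m"
      have j: "j < m"
      proof -
        have "\<tau> m \<in> {..<n}"
          using permutes_in_image[OF less.prems(1), of m] by (simp add: Suc)
        then show ?thesis
          using False by (simp add: j_def Suc)
      qed
      obtain k where k: "m = Suc k"
        using less_imp_Suc_add[OF j] by blast
      \<comment> \<open>The maps are chosen so that \<open>s \<circ> t \<circ> \<tau>\<close> sends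
        m to j, then to k, then back to m. As transpositions are involutions, \<tau> =
        \<open>t \<circ> s \<circ> \<rho>\<close>, where t and \<rho> fix m and s swaps the last two
        coordinates.\<close>
      define t where "t = Transposition.transpose j k"
      define s where "s = Transposition.transpose k m"
      define \<rho> where "\<rho> = s \<circ> t \<circ> \<tau>"
      have t: "t permutes {..<m}" and s: "s permutes {..<n}"
        unfolding t_def s_def using j by (intro permutes_swap_id; simp add: Suc k)+
      have t': "t permutes {..<n}"
        using t by (rule permutes_subset) (simp add: Suc)
      have "\<rho> permutes {..<n}"
        unfolding \<rho>_def by (intro permutes_compose less.prems(1) s t')
      moreover have "\<rho> m = m"
        by (simp add: \<rho>_def t_def s_def j_def[symmetric])
      ultimately have \<rho>: "\<rho> permutes {..<m}"
        unfolding Suc by (rule permutes_lessThan_fix_last)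
      have "\<rho> permutes {..<n}"
        using \<rho> by (rule permutes_subset) (simp add: Suc)
      then have bcs: "bounded_cs (power_top n) (pullback n n \<rho> f)"
        by (intro bounded_cs_pullback less.prems(2) permutes_image)
      have bcs': "bounded_cs (power_top n) (pullback n n s (pullback n n \<rho> f))"
        by (rule bounded_cs_pullback[OF bcs permutes_image[OF s]])
      have \<tau>: "\<tau> = t \<circ> (s \<circ> \<rho>)"
        by (simp add: \<rho>_def t_def s_def fun_eq_iff)
      have "pullback n n \<tau> f = pullback n n t (pullback n n s (pullback n n \<rho> f))"
        unfolding \<tau> using permutes_image[OF s] permutes_image[OF \<open>\<rho> permutes {..<n}\<close>]
        by (subst (1 2) pullback_pullback) (auto simp: image_comp[symmetric] simp del: image_comp)
      then have "pairing n (falling_power \<omega> n) (pullback n n \<tau> f) =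
          pairing n (falling_power \<omega> n) (pullback n n s (pullback n n \<rho> f))"
        using fix_last[OF Suc t bcs'] by simp
      also have "\<dots> = pairing n (falling_power \<omega> n) (pullback n n \<rho> f)"
      proof -
        let ?g = "pullback n n \<rho> f"
        have "pairing n (falling_power \<omega> n) g =
            pairing k (falling_power \<omega> k) (diagonal_step \<omega> {..<k} k (diagonal_step \<omega> {..<Suc k} (Suc k) g))"
          if "bounded_cs (power_top n) g" for g
          using that unfolding Suc k
          by (simp only: pairing_falling_power_Suc[OF lc \<omega>] bounded_cs_diagonal_step[OF lc \<omega> subset_refl])
        then show ?thesis
          using bcs bcs' diagonal_step_twice_transpose[of k ?g] Suc k by (simp add: s_def)
      qed
      also have "\<dots> = pairing n (falling_power \<omega> n) f"
        by (rule fix_last[OF Suc \<rho> less.prems(2)])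
      finally show ?thesis .
    qed
  qed
qed

end

section \<open>Stirling operators\<close>

text \<open>The set partitions of \<open>{..<n}\<close> into \<open>k\<close> blocks, encoded by the map sending an element to the
  index of its block; the blocks are numbered by their least elements.\<close>

primrec block_maps :: "nat \<Rightarrow> (nat \<times> (nat \<Rightarrow> nat)) list" where
  "block_maps 0 = [(0, id)]"
| "block_maps (Suc n) =
     concat (map (\<lambda>(k, \<sigma>). (Suc k, \<sigma>(n := k)) # map (\<lambda>i. (k, \<sigma>(n := i))) [0..<k]) (block_maps n))"

lemma block_maps_image:
  "(k, \<sigma>) \<in> set (block_maps n) \<Longrightarrow> \<sigma> ` {..<n} = {..<k}"
proof (induction n arbitrary: k \<sigma>)
  case (Suc n)
  then obtain j \<tau> where \<tau>: "(j, \<tau>) \<in> set (block_maps n)"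
    and "(k, \<sigma>) \<in> set ((Suc j, \<tau>(n := j)) # map (\<lambda>i. (j, \<tau>(n := i))) [0..<j])"
    unfolding block_maps.simps set_concat set_map by fast
  then have "(k = Suc j \<and> \<sigma> = \<tau>(n := j)) \<or> (k = j \<and> (\<exists>i<j. \<sigma> = \<tau>(n := i)))"
    by auto
  moreover have "\<tau>(n := i) ` {..<Suc n} = insert i (\<tau> ` {..<n})" for i
    by (auto simp: lessThan_Suc)
  ultimately show ?case
    using Suc.IH[OF \<tau>] by (elim disjE exE conjE) (simp only:, auto)+
qed auto

lemma block_maps_le:
  assumes "(k, \<sigma>) \<in> set (block_maps n)"
  shows "k \<le> n"
  using card_image_le[of "{..<n}" \<sigma>] block_maps_image[OF assms] by simp

lemma sum_list_concat_map: "sum_list (concat xss) = sum_list (map sum_list xss)"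
  by (induction xss) auto

lemma sum_list_by_fst:
  assumes "\<And>j s. (j, s) \<in> set xs \<Longrightarrow> j \<le> N"
  shows "(\<Sum>(j, s)\<leftarrow>xs. F j s) = (\<Sum>k\<le>(N::nat). \<Sum>(j, s)\<leftarrow>xs. if j = k then F k s else (0 :: 'b::comm_monoid_add))"
  using assms
proof (induction xs)
  case (Cons p xs)
  obtain j s where p: "p = (j, s)" by force
  have "F j s = (\<Sum>k\<le>N. if j = k then F k s else 0)"
    using Cons.prems[of j s] p by simp
  moreover have "(\<Sum>(j, s)\<leftarrow>xs. F j s) = (\<Sum>k\<le>N. \<Sum>(j, s)\<leftarrow>xs. if j = k then F k s else 0)"
    using Cons.prems by (intro Cons.IH) auto
  ultimately show ?case
    using p by (simp add: sum.distrib)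
qed simp

definition block_sum :: "nat \<Rightarrow> nat \<Rightarrow> ((nat \<Rightarrow> 'a::topological_space) \<Rightarrow> 'f::comm_monoid_add) \<Rightarrow> (nat \<Rightarrow> 'a) \<Rightarrow> 'f" where
  "block_sum n k f x = (\<Sum>(j, \<sigma>)\<leftarrow>block_maps n. if j = k then pullback n k \<sigma> f x else 0)"

text \<open>Averaging is necessary even if the original function is symmetric, because numbering
  blocks by their least elements is not a symmetric choice: for n = 3 and k = 2 a symmetric f has
  the block sum 2 f(x,x,y) + f(x,y,y).\<close>

definition symmetrize :: "nat \<Rightarrow> ((nat \<Rightarrow> 'a::topological_space) \<Rightarrow> 'f::real_normed_field) \<Rightarrow> (nat \<Rightarrow> 'a) \<Rightarrow> 'f" where
  "symmetrize k f x = inverse (fact k) * (\<Sum>\<tau> | \<tau> permutes {..<k}. pullback k k \<tau> f x)"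

text \<open>The explicit candidate for the Stirling operator. It is also meaningful for n = 0, where
  the empty partition passes the constant term of a polynomial through unchanged.\<close>

definition stirling :: "nat \<Rightarrow> nat \<Rightarrow> ((nat \<Rightarrow> 'a::topological_space) \<Rightarrow> 'f::real_normed_field) \<Rightarrow> (nat \<Rightarrow> 'a) \<Rightarrow> 'f" where
  "stirling n k f = symmetrize k (block_sum n k f)"

lemma bounded_cs_block_sum:
  fixes f :: "(nat \<Rightarrow> 'a::polish_space) \<Rightarrow> 'f::{real_normed_field,euclidean_space}"
  assumes f: "bounded_cs (power_top n) f"
  shows "bounded_cs (power_top k) (block_sum n k f)"
proof -
  have "bounded_cs (power_top k) (\<lambda>x. \<Sum>(j, \<sigma>)\<leftarrow>xs. if j = k then pullback n k \<sigma> f x else 0)"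
    if "set xs \<subseteq> set (block_maps n)" for xs
    using that
  proof (induction xs)
    case (Cons p xs)
    obtain j \<sigma> where p: "p = (j, \<sigma>)" by force
    have "bounded_cs (power_top k) (\<lambda>x. if j = k then pullback n k \<sigma> f x else 0)"
      using bounded_cs_pullback[OF f] block_maps_image[of j \<sigma> n] Cons.prems p
      by (cases "j = k") (simp_all add: bounded_cs_zero)
    with Cons show ?case
      by (simp add: p bounded_cs_add)
  qed (simp add: bounded_cs_zero)
  then show ?thesis
    unfolding block_sum_def[abs_def] by blast
qed

lemma bounded_cs_symmetrize:
  fixes f :: "(nat \<Rightarrow> 'a::polish_space) \<Rightarrow> 'f::{real_normed_field,euclidean_space}"
  assumes "bounded_cs (power_top k) f"
  shows "bounded_cs (power_top k) (symmetrize k f)"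
  unfolding symmetrize_def[abs_def]
  by (intro bounded_cs_mult_left bounded_cs_sum bounded_cs_pullback[OF assms] permutes_image) simp

lemma symmetrize_permutes:
  assumes \<pi>: "\<pi> permutes {..<k}" and x: "x \<in> topspace (power_top k)"
  shows "symmetrize k f (x \<circ> \<pi>) = symmetrize k f x"
proof -
  have x': "x \<circ> \<pi> \<in> topspace (power_top k)"
    using x \<pi> by (auto simp: PiE_def extensional_def permutes_def)
  have "(\<Sum>\<tau> | \<tau> permutes {..<k}. f (x \<circ> \<pi> \<circ> \<tau>)) = (\<Sum>\<tau> | \<tau> permutes {..<k}. f (x \<circ> \<tau>))"
    using setum_permutations_compose_left[OF \<pi>, of "\<lambda>\<tau>. f (x \<circ> \<tau>)"] by (simp add: comp_assoc)
  moreover have "symmetrize k f y = inverse (fact k) * (\<Sum>\<tau> | \<tau> permutes {..<k}. f (y \<circ> \<tau>))"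
    if "y \<in> topspace (power_top k)" for y
    unfolding symmetrize_def by (intro arg_cong2[where f="(*)"] sum.cong refl pullback_permutes that) simp
  ultimately show ?thesis
    using x x' by simp
qed

text \<open>In a Hausdorff space a set contained in a compact set has compact closure, so the
  condition on the closed support and the one in \<open>bounded_cs\<close> coincide; what remains is
  symmetry.\<close>

lemma test_functions_iff:
  fixes f :: "(nat \<Rightarrow> 'a::polish_space) \<Rightarrow> 'f::{real_normed_field,euclidean_space}"
  shows "f \<in> test_functions n \<longleftrightarrow> bounded_cs (power_top n) f \<and>
    (\<forall>\<pi>. \<pi> permutes {..<n} \<longrightarrow> (\<forall>x\<in>topspace (power_top n). f (x \<circ> \<pi>) = f x))"
proof (intro iffI conjI)
  let ?S = "{x \<in> topspace (power_top n). f x \<noteq> 0}"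
  assume f: "f \<in> test_functions n"
  then show "\<forall>\<pi>. \<pi> permutes {..<n} \<longrightarrow> (\<forall>x\<in>topspace (power_top n). f (x \<circ> \<pi>) = f x)"
    by (simp add: test_functions_def)
  obtain B where B: "\<And>x. x \<in> topspace (power_top n) \<Longrightarrow> norm (f x) \<le> B"
    using f unfolding test_functions_def by blast
  have out: "f x = 0" if "x \<notin> topspace (power_top n)" for x
    using f that unfolding test_functions_def by blast
  have "norm (f x) \<le> max B 0" for x
    using B[of x] out[of x] by (cases "x \<in> topspace (power_top n)") auto
  moreover have "f x = 0" if "x \<notin> power_top n closure_of ?S" for x
  proof (rule ccontr)
    assume "f x \<noteq> 0"
    then have "x \<in> ?S" using out by auto
    then show False
      using closure_of_subset[of ?S "power_top n"] that by blast
  qed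
  ultimately show "bounded_cs (power_top n) f"
    using f unfolding bounded_cs_def test_functions_def by blast
next
  assume *: "bounded_cs (power_top n) f \<and>
    (\<forall>\<pi>. \<pi> permutes {..<n} \<longrightarrow> (\<forall>x\<in>topspace (power_top n). f (x \<circ> \<pi>) = f x))"
  let ?S = "{x \<in> topspace (power_top n). f x \<noteq> 0}"
  obtain K where K: "compactin (power_top n) K" "\<And>x. x \<notin> K \<Longrightarrow> f x = 0"
    using * unfolding bounded_cs_def by blast
  have "power_top n closure_of ?S \<subseteq> K"
    using K by (intro closure_of_minimal compactin_imp_closedin Hausdorff_power_top) auto
  then have "compactin (power_top n) (power_top n closure_of ?S)"
    using K(1) closed_compactin closedin_closure_of by blast
  then show "f \<in> test_functions n"
    using * bounded_cs_power_outside[of n f] unfolding test_functions_def bounded_cs_def by blast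
qed

lemma stirling_test_functions:
  fixes f :: "(nat \<Rightarrow> 'a::polish_space) \<Rightarrow> 'f::{real_normed_field,euclidean_space}"
  assumes "f \<in> test_functions n"
  shows "stirling n k f \<in> test_functions k"
  using assms unfolding test_functions_iff stirling_def
  by (auto intro!: bounded_cs_symmetrize bounded_cs_block_sum symmetrize_permutes)

section \<open>Linearity of the explicit operators and the case of no blocks\<close>

lemma stirling_add: "stirling n k (\<lambda>x. f x + g x) = (\<lambda>x. stirling n k f x + stirling n k g x)"
proof -
  have p: "pullback m k \<sigma> (\<lambda>x. f x + g x) y = pullback m k \<sigma> f y + pullback m k \<sigma> g y"
    for m \<sigma> y and f g :: "(nat \<Rightarrow> 'a) \<Rightarrow> 'b"
    by (simp add: pullback_def)
  have "block_sum n k (\<lambda>x. f x + g x) = (\<lambda>y. block_sum n k f y + block_sum n k g y)"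
    unfolding block_sum_def[abs_def] sum_list_addf[symmetric]
    by (intro ext arg_cong[where f=sum_list] map_cong refl) (auto simp: p)
  then show ?thesis
    by (simp add: stirling_def symmetrize_def[abs_def] p sum.distrib distrib_left)
qed

lemma stirling_mult_left: "stirling n k (\<lambda>x. c * f x) = (\<lambda>x. c * stirling n k f x)"
proof -
  have p: "pullback m k \<sigma> (\<lambda>x. c * f x) y = c * pullback m k \<sigma> f y"
    for m \<sigma> y and f :: "(nat \<Rightarrow> 'a) \<Rightarrow> 'b"
    by (simp add: pullback_def)
  have "block_sum n k (\<lambda>x. c * f x) = (\<lambda>y. c * block_sum n k f y)"
    unfolding block_sum_def[abs_def] sum_list_const_mult[symmetric]
    by (intro ext arg_cong[where f=sum_list] map_cong refl) (auto simp: p)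
  then show ?thesis
    by (simp add: stirling_def symmetrize_def[abs_def] p sum_distrib_left mult.left_commute)
qed

text \<open>A nonempty set has no partition into zero blocks. This reconciles sums starting at 0
  with the defining relation of the Stirling operators, which starts at 1.\<close>

lemma stirling_0:
  assumes "n \<ge> 1"
  shows "stirling n 0 f = (\<lambda>_. 0)"
proof -
  have ne: "(0, \<sigma>) \<notin> set (block_maps n)" for \<sigma>
    using block_maps_image[of 0 \<sigma> n] assms by (auto simp: lessThan_empty_iff)
  have "(\<Sum>(j, \<sigma>)\<leftarrow>block_maps n. if j = 0 then pullback n 0 \<sigma> f x else 0) = (\<Sum>_\<leftarrow>block_maps n. 0)" for x
    using ne by (intro arg_cong[where f=sum_list] map_cong refl) auto
  then have "block_sum n 0 f = (\<lambda>_. 0)"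
    by (simp add: block_sum_def fun_eq_iff)
  then show ?thesis
    by (simp add: stirling_def symmetrize_def[abs_def] pullback_def)
qed

section \<open>Expansion of tensor powers in falling powers\<close>

context
  fixes \<omega> :: "'a::polish_space set \<Rightarrow> 'f::{real_normed_field,euclidean_space}"
  assumes lc: "locally_compact_space (euclidean :: 'a topology)"
    and \<omega>: "\<omega> \<in> radon_measures euclidean"
begin

lemma pairing_falling_add:
  "bounded_cs (power_top n) f \<Longrightarrow> bounded_cs (power_top n) g \<Longrightarrow>
    pairing n (falling_power \<omega> n) (\<lambda>x. f x + g x) =
    pairing n (falling_power \<omega> n) f + pairing n (falling_power \<omega> n) g"
  unfolding pairing_def by (rule radon_integral_add[OF Hausdorff_power_top falling_power_radon[OF lc \<omega>]])

lemma pairing_falling_diff: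
  "bounded_cs (power_top n) f \<Longrightarrow> bounded_cs (power_top n) g \<Longrightarrow>
    pairing n (falling_power \<omega> n) (\<lambda>x. f x - g x) =
    pairing n (falling_power \<omega> n) f - pairing n (falling_power \<omega> n) g"
  unfolding pairing_def by (rule radon_integral_diff[OF Hausdorff_power_top falling_power_radon[OF lc \<omega>]])

lemma pairing_falling_mult_left:
  "bounded_cs (power_top n) f \<Longrightarrow>
    pairing n (falling_power \<omega> n) (\<lambda>x. c * f x) = c * pairing n (falling_power \<omega> n) f"
  unfolding pairing_def by (rule radon_integral_mult_left[OF Hausdorff_power_top falling_power_radon[OF lc \<omega>]])

lemma pairing_falling_zero: "pairing n (falling_power \<omega> n) (\<lambda>_. 0) = 0"
  unfolding pairing_def by (rule radon_integral_zero[OF Hausdorff_power_top falling_power_radon[OF lc \<omega>]])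

lemma pairing_falling_sum:
  "(\<And>i. i \<in> I \<Longrightarrow> bounded_cs (power_top n) (f i)) \<Longrightarrow>
    pairing n (falling_power \<omega> n) (\<lambda>x. \<Sum>i\<in>I. f i x) = (\<Sum>i\<in>I. pairing n (falling_power \<omega> n) (f i))"
  unfolding pairing_def by (rule radon_integral_sum[OF Hausdorff_power_top falling_power_radon[OF lc \<omega>]])

lemma pairing_falling_integrate_last:
  assumes h: "bounded_cs (power_top (Suc k)) h"
  shows "pairing k (falling_power \<omega> k) (integrate_last \<omega> k h) =
    pairing (Suc k) (falling_power \<omega> (Suc k)) h
    + (\<Sum>i<k. pairing k (falling_power \<omega> k) (pullback (Suc k) k (id(k := i)) h))"
proof -
  have p: "bounded_cs (power_top k) (pullback (Suc k) k (id(k := i)) h)" if "i \<in> {..<k}" for i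
    using that by (intro bounded_cs_pullback h image_diagonal) auto
  have "pairing (Suc k) (falling_power \<omega> (Suc k)) h = pairing k (falling_power \<omega> k) (integrate_last \<omega> k h)
      - pairing k (falling_power \<omega> k) (\<lambda>x. \<Sum>i<k. pullback (Suc k) k (id(k := i)) h x)"
    unfolding pairing_falling_power_Suc[OF lc \<omega> h] diagonal_step_def[abs_def]
    by (intro pairing_falling_diff bounded_cs_integrate_last[OF lc \<omega> h] bounded_cs_sum p)
  also have "pairing k (falling_power \<omega> k) (\<lambda>x. \<Sum>i<k. pullback (Suc k) k (id(k := i)) h x) =
      (\<Sum>i<k. pairing k (falling_power \<omega> k) (pullback (Suc k) k (id(k := i)) h))"
    by (rule pairing_falling_sum[OF p])
  finally show ?thesis by simp
qed

text \<open>The induction hypothesis is applied to f with its last variable integrated out. For each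
  partition of the first n positions, the integral against \<omega> then either leaves position n
  free, as the new block k, or identifies it with a block i < k; these are the two kinds of entries
  in the recursion of \<open>block_maps\<close>.\<close>

lemma pairing_tensor_power_blocks:
  assumes "bounded_cs (power_top n) f"
  shows "pairing n (tensor_power \<omega> n) f =
    (\<Sum>(k, \<sigma>)\<leftarrow>block_maps n. pairing k (falling_power \<omega> k) (pullback n k \<sigma> f))"
  using assms
proof (induction n arbitrary: f)
  case 0
  then show ?case
    using pullback_id[OF 0] by (simp add: id_def)
next
  case (Suc n)
  have "pairing k (falling_power \<omega> k) (pullback n k \<sigma> (integrate_last \<omega> n f)) =
      pairing (Suc k) (falling_power \<omega> (Suc k)) (pullback (Suc n) (Suc k) (\<sigma>(n := k)) f)
      + (\<Sum>i\<leftarrow>[0..<k]. pairing k (falling_power \<omega> k) (pullback (Suc n) k (\<sigma>(n := i)) f))"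
    if "(k, \<sigma>) \<in> set (block_maps n)" for k \<sigma>
  proof -
    note \<sigma> = block_maps_image[OF that]
    have im: "\<sigma>(n := k) ` {..<Suc n} = {..<Suc k}"
      using \<sigma> by (auto simp: lessThan_Suc)
    have h: "bounded_cs (power_top (Suc k)) (pullback (Suc n) (Suc k) (\<sigma>(n := k)) f)"
      by (rule bounded_cs_pullback[OF Suc.prems im])
    have pp: "pullback (Suc k) k (id(k := i)) (pullback (Suc n) (Suc k) (\<sigma>(n := k)) f) =
        pullback (Suc n) k (\<sigma>(n := i)) f" if "i < k" for i
    proof -
      \<comment> \<open>Positions below n have values of \<sigma> below k, so
        \<open>id(k := i)\<close> moves only the new position.\<close>
      have "(id(k := i) \<circ> \<sigma>(n := k)) j = (\<sigma>(n := i)) j" if "j < Suc n" for j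
        using \<sigma> that by (cases "j = n") (auto simp: less_Suc_eq)
      then have "pullback (Suc n) k (id(k := i) \<circ> \<sigma>(n := k)) f = pullback (Suc n) k (\<sigma>(n := i)) f"
        by (rule pullback_cong)
      then show ?thesis
        by (subst pullback_pullback) (simp_all only: im order_refl)
    qed
    have "pullback n k \<sigma> (integrate_last \<omega> n f) = integrate_last \<omega> k (pullback (Suc n) (Suc k) (\<sigma>(n := k)) f)"
      using \<sigma> by (intro pullback_integrate_last) simp
    then show ?thesis
      using pp by (simp add: pairing_falling_integrate_last[OF h] interv_sum_list_conv_sum_set_nat atLeast0LessThan)
  qed
  then have "(\<Sum>(k, \<sigma>)\<leftarrow>block_maps n. pairing k (falling_power \<omega> k) (pullback n k \<sigma> (integrate_last \<omega> n f))) =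
      (\<Sum>(k, \<sigma>)\<leftarrow>block_maps n. pairing (Suc k) (falling_power \<omega> (Suc k)) (pullback (Suc n) (Suc k) (\<sigma>(n := k)) f)
      + (\<Sum>i\<leftarrow>[0..<k]. pairing k (falling_power \<omega> k) (pullback (Suc n) k (\<sigma>(n := i)) f)))"
    by (intro arg_cong[where f=sum_list] map_cong refl) auto
  also have "\<dots> = (\<Sum>(k, \<sigma>)\<leftarrow>block_maps (Suc n). pairing k (falling_power \<omega> k) (pullback (Suc n) k \<sigma> f))"
    by (simp add: map_concat sum_list_concat_map comp_def case_prod_unfold)
  finally show ?case
    using Suc by (simp only: pairing_tensor_power_Suc[OF lc \<omega>] bounded_cs_integrate_last[OF lc \<omega>])
qed

lemma pairing_falling_block_sum:
  assumes f: "bounded_cs (power_top n) f"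
  shows "pairing k (falling_power \<omega> k) (block_sum n k f) =
    (\<Sum>(j, \<sigma>)\<leftarrow>block_maps n. if j = k then pairing k (falling_power \<omega> k) (pullback n k \<sigma> f) else 0)"
proof -
  \<comment> \<open>Boundedness is carried through the induction because additivity of the pairing
    requires it of the tail.\<close>
  have "bounded_cs (power_top k) (\<lambda>x. \<Sum>(j, \<sigma>)\<leftarrow>xs. if j = k then pullback n k \<sigma> f x else 0) \<and>
    pairing k (falling_power \<omega> k) (\<lambda>x. \<Sum>(j, \<sigma>)\<leftarrow>xs. if j = k then pullback n k \<sigma> f x else 0) =
    (\<Sum>(j, \<sigma>)\<leftarrow>xs. if j = k then pairing k (falling_power \<omega> k) (pullback n k \<sigma> f) else 0)"
    if "set xs \<subseteq> set (block_maps n)" for xs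
    using that
  proof (induction xs)
    case (Cons p xs)
    obtain j \<sigma> where p: "p = (j, \<sigma>)" by force
    have b: "bounded_cs (power_top k) (\<lambda>x. if j = k then pullback n k \<sigma> f x else 0)"
      using bounded_cs_pullback[OF f] block_maps_image[of j \<sigma> n] Cons.prems p
      by (cases "j = k") (simp_all add: bounded_cs_zero)
    have "pairing k (falling_power \<omega> k) (\<lambda>x. if j = k then pullback n k \<sigma> f x else 0) =
        (if j = k then pairing k (falling_power \<omega> k) (pullback n k \<sigma> f) else 0)"
      by (simp add: pairing_falling_zero)
    with Cons b show ?case
      by (simp add: p bounded_cs_add pairing_falling_add)
  qed (simp add: bounded_cs_zero pairing_falling_zero)
  then show ?thesis
    unfolding block_sum_def[abs_def] by blast
qed

lemma pairing_falling_symmetrize: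
  assumes "bounded_cs (power_top k) f"
  shows "pairing k (falling_power \<omega> k) (symmetrize k f) = pairing k (falling_power \<omega> k) f"
proof -
  have p: "bounded_cs (power_top k) (pullback k k \<tau> f)" if "\<tau> \<in> {\<tau>. \<tau> permutes {..<k}}" for \<tau>
    using that by (intro bounded_cs_pullback assms permutes_image) simp
  have "pairing k (falling_power \<omega> k) (symmetrize k f) =
      inverse (fact k) * (\<Sum>\<tau> | \<tau> permutes {..<k}. pairing k (falling_power \<omega> k) (pullback k k \<tau> f))"
    unfolding symmetrize_def[abs_def]
    by (subst pairing_falling_mult_left, rule bounded_cs_sum[OF p], assumption)
       (subst pairing_falling_sum[OF p], assumption, rule refl)
  also have "\<dots> = inverse (fact k) * (\<Sum>\<tau> | \<tau> permutes {..<k}. pairing k (falling_power \<omega> k) f)"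
    using assms by (simp add: pairing_falling_power_permutes[OF lc \<omega>])
  also have "\<dots> = pairing k (falling_power \<omega> k) f"
    by (simp add: card_permutations[of "{..<k}" k])
  finally show ?thesis .
qed

text \<open>The bound N may exceed n: there are no partitions into more than n blocks. Monomials of
  different orders can thus be expanded over a common range.\<close>

lemma pairing_tensor_power_stirling:
  assumes f: "bounded_cs (power_top n) f" and "n \<le> N"
  shows "pairing n (tensor_power \<omega> n) f = (\<Sum>k\<le>N. pairing k (falling_power \<omega> k) (stirling n k f))"
proof -
  have "pairing n (tensor_power \<omega> n) f =
     (\<Sum>k\<le>N. \<Sum>(j, \<sigma>)\<leftarrow>block_maps n. if j = k then pairing k (falling_power \<omega> k) (pullback n k \<sigma> f) else 0)"
    unfolding pairing_tensor_power_blocks[OF f]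
    using block_maps_le assms(2) by (intro sum_list_by_fst) (meson order_trans)
  also have "\<dots> = (\<Sum>k\<le>N. pairing k (falling_power \<omega> k) (stirling n k f))"
    unfolding stirling_def
    by (simp add: pairing_falling_symmetrize[OF bounded_cs_block_sum[OF f]] pairing_falling_block_sum[OF f])
  finally show ?thesis .
qed

end

section \<open>Evaluation on finite sums of Dirac measures\<close>

lemma represents_sum_dirac:
  fixes x :: "nat \<Rightarrow> 'a::metric_space"
  assumes "finite I"
  shows "represents euclidean I (\<lambda>_. 1 :: 'f::{real_normed_field,euclidean_space})
    (\<lambda>i. return (borel_of euclidean) (x i)) (sum_dirac x I)"
  unfolding represents_def
proof (intro conjI ballI allI assms)
  have r: "represents euclidean {()} (\<lambda>_. 1 :: 'f) (\<lambda>_. return (borel_of euclidean) (x i)) (dirac euclidean (x i))" for i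
    by (rule represents_dirac) simp_all
  show "nonneg_radon euclidean (return (borel_of euclidean) (x i))" for i
    using r[of i] by (simp add: represents_def)
  have "dirac euclidean (x i) A = (if A \<in> precompact_sets euclidean
      then measure (return (borel_of euclidean) (x i)) A *\<^sub>R 1 else (0 :: 'f))" for i A
    using r[of i] by (simp add: represents_def)
  then show "sum_dirac x I A = (if A \<in> precompact_sets euclidean
      then \<Sum>i\<in>I. measure (return (borel_of euclidean) (x i)) A *\<^sub>R 1 else (0 :: 'f))" for A
    by (simp add: sum_dirac_def)
qed

lemma sum_dirac_radon:
  fixes x :: "nat \<Rightarrow> 'a::metric_space"
  assumes "finite I"
  shows "(sum_dirac x I :: 'a set \<Rightarrow> 'f::{real_normed_field,euclidean_space}) \<in> radon_measures euclidean"
  by (rule represents_radon_measures[OF Hausdorff_space_euclidean represents_sum_dirac[OF assms]])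

lemma radon_integral_sum_dirac:
  fixes x :: "nat \<Rightarrow> 'a::metric_space" and f :: "'a \<Rightarrow> 'f::{real_normed_field,euclidean_space}"
  assumes "finite I" "bounded_cs euclidean f"
  shows "radon_integral euclidean (sum_dirac x I) f = (\<Sum>i\<in>I. f (x i))"
proof -
  have "f \<in> borel_measurable (borel_of euclidean)"
    using assms(2) by (simp add: bounded_cs_def)
  then have "integral\<^sup>L (return (borel_of euclidean) (x i)) f = f (x i)" for i
    by (intro integral_return) auto
  then show ?thesis
    by (simp add: represents_radon_integral[OF Hausdorff_space_euclidean represents_sum_dirac[OF assms(1)] assms(2)])
qed

definition injections :: "nat \<Rightarrow> 'i set \<Rightarrow> (nat \<Rightarrow> 'i) set" where
  "injections m I = {s \<in> {..<m} \<rightarrow>\<^sub>E I. inj_on s {..<m}}"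

lemma finite_injections: "finite I \<Longrightarrow> finite (injections m I)"
  unfolding injections_def by (rule finite_subset[of _ "{..<m} \<rightarrow>\<^sub>E I"]) (auto intro: finite_PiE)

text \<open>Extending an injection by one argument amounts to choosing a value off its image, which
  mirrors the removal of the earlier points in the kernel of the falling power.\<close>

lemma sum_injections_Suc:
  fixes F :: "(nat \<Rightarrow> 'i) \<Rightarrow> 'b::comm_monoid_add"
  assumes "finite I"
  shows "(\<Sum>s\<in>injections (Suc m) I. F s) = (\<Sum>s\<in>injections m I. \<Sum>i\<in>I - s ` {..<m}. F (s(m := i)))"
proof -
  have "(\<Sum>s\<in>injections m I. \<Sum>i\<in>I - s ` {..<m}. F (s(m := i))) =
      (\<Sum>(s, i)\<in>(SIGMA s:injections m I. I - s ` {..<m}). F (s(m := i)))"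
    using assms by (intro sum.Sigma finite_injections) auto
  also have "\<dots> = (\<Sum>s\<in>injections (Suc m) I. F s)"
  proof (rule sum.reindex_bij_witness[where j="\<lambda>(s, i). s(m := i)" and i="\<lambda>s. (s(m := undefined), s m)"])
    fix p assume "p \<in> (SIGMA s:injections m I. I - s ` {..<m})"
    then obtain s i where p: "p = (s, i)" "s \<in> {..<m} \<rightarrow>\<^sub>E I" "inj_on s {..<m}" "i \<in> I" "i \<notin> s ` {..<m}"
      by (auto simp: injections_def)
    have "s m = undefined"
      using p(2) by auto
    then show "((case p of (s, i) \<Rightarrow> s(m := i))(m := undefined), (case p of (s, i) \<Rightarrow> s(m := i)) m) = p"
      by (simp add: p(1) fun_upd_idem)
    have "inj_on (s(m := i)) {..<Suc m}"
      using p(3,5) by (auto simp: inj_on_def less_Suc_eq)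
    moreover have "s(m := i) \<in> {..<Suc m} \<rightarrow>\<^sub>E I"
      using p(2,4) by (auto simp: PiE_def extensional_def less_Suc_eq)
    ultimately show "(case p of (s, i) \<Rightarrow> s(m := i)) \<in> injections (Suc m) I"
      by (simp add: p(1) injections_def)
    show "F (case p of (s, i) \<Rightarrow> s(m := i)) = (case p of (s, i) \<Rightarrow> F (s(m := i)))"
      by (simp add: p(1))
  next
    fix s assume "s \<in> injections (Suc m) I"
    then have s: "s \<in> {..<Suc m} \<rightarrow>\<^sub>E I" "inj_on s {..<Suc m}"
      by (auto simp: injections_def)
    show "(case (s(m := undefined), s m) of (s, i) \<Rightarrow> s(m := i)) = s"
      by simp
    have "s(m := undefined) \<in> {..<m} \<rightarrow>\<^sub>E I"
      using s(1) by (auto simp: PiE_def extensional_def)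
    moreover have "inj_on (s(m := undefined)) {..<m}"
      using s(2) by (auto simp: inj_on_def)
    moreover have "s m \<in> I" "s m \<notin> (s(m := undefined)) ` {..<m}"
      using s by (auto simp: inj_on_def) (metis lessI lessThan_iff less_SucI less_irrefl_nat)
    ultimately show "(s(m := undefined), s m) \<in> (SIGMA s:injections m I. I - s ` {..<m})"
      by (simp add: injections_def)
  qed
  finally show ?thesis ..
qed

text \<open>At each step the measure contributes all indices in I and the subtracted diagonals
  cancel exactly those already used. The injections go into the index set and not into the set of
  atoms, so coinciding points x i are harmless.\<close>

lemma pairing_falling_sum_dirac:
  fixes x :: "nat \<Rightarrow> 'a::polish_space" and f :: "(nat \<Rightarrow> 'a) \<Rightarrow> 'f::{real_normed_field,euclidean_space}"
  assumes lc: "locally_compact_space (euclidean :: 'a topology)" and I: "finite I"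
    and f: "bounded_cs (power_top m) f"
  shows "pairing m (falling_power (sum_dirac x I) m) f = (\<Sum>s\<in>injections m I. f (restrict (x \<circ> s) {..<m}))"
  using f
proof (induction m arbitrary: f)
  case 0
  have "injections 0 I = {\<lambda>_. undefined}"
    by (auto simp: injections_def)
  then show ?case
    using 0 by (simp add: pairing_unit restrict_def)
next
  case (Suc m)
  let ?\<omega> = "sum_dirac x I :: 'a set \<Rightarrow> 'f"
  have \<omega>: "?\<omega> \<in> radon_measures euclidean"
    by (rule sum_dirac_radon[OF I])
  have "pairing (Suc m) (falling_power ?\<omega> (Suc m)) f =
      (\<Sum>s\<in>injections m I. diagonal_step ?\<omega> {..<m} m f (restrict (x \<circ> s) {..<m}))"
    unfolding pairing_falling_power_Suc[OF lc \<omega> Suc.prems]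
    by (intro Suc.IH bounded_cs_diagonal_step[OF lc \<omega> subset_refl] Suc.prems)
  also have "\<dots> = (\<Sum>s\<in>injections m I. \<Sum>i\<in>I - s ` {..<m}. f (restrict (x \<circ> s(m := i)) {..<Suc m}))"
  proof (rule sum.cong[OF refl])
    fix s assume "s \<in> injections m I"
    then have s: "s ` {..<m} \<subseteq> I" "inj_on s {..<m}"
      by (auto simp: injections_def)
    let ?u = "restrict (x \<circ> s) {..<m}"
    have upd: "?u(m := x i) = restrict (x \<circ> s(m := i)) {..<Suc m}" for i
      by (auto simp: fun_eq_iff less_Suc_eq)
    have "diagonal_step ?\<omega> {..<m} m f ?u = (\<Sum>i\<in>I. f (?u(m := x i))) - (\<Sum>j<m. f (?u(m := ?u j)))"
      unfolding diagonal_step_apply[OF restrict_in_power]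
      by (simp only: radon_integral_sum_dirac[OF I bounded_cs_section[OF Suc.prems restrict_in_power]])
    also have "(\<Sum>j<m. f (?u(m := ?u j))) = (\<Sum>i\<in>s ` {..<m}. f (?u(m := x i)))"
      by (simp add: sum.reindex[OF s(2)])
    also have "(\<Sum>i\<in>I. f (?u(m := x i))) - \<dots> = (\<Sum>i\<in>I - s ` {..<m}. f (?u(m := x i)))"
      using I s(1) by (intro sum_diff[symmetric])
    finally show "diagonal_step ?\<omega> {..<m} m f ?u = (\<Sum>i\<in>I - s ` {..<m}. f (restrict (x \<circ> s(m := i)) {..<Suc m}))"
      unfolding upd .
  qed
  also have "\<dots> = (\<Sum>s\<in>injections (Suc m) I. f (restrict (x \<circ> s) {..<Suc m}))"
    by (rule sum_injections_Suc[OF I, symmetric])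
  finally show ?case .
qed

section \<open>Moebius inversion over the atoms\<close>

lemma surjective_injections:
  "{s \<in> injections k {..<k}. s ` {..<k} = {..<k}} = injections k {..<k}"
proof -
  have "s ` {..<k} = {..<k}" if "s \<in> injections k {..<k}" for s
    using that by (intro endo_inj_surj) (auto simp: injections_def)
  then show ?thesis by auto
qed

lemma card_injections: "card (injections k {..<k}) = fact k"
proof -
  have "card (injections k {..<k}) = (\<Prod>i = 0..<k. k - i)"
    using card_inj_on_subset_funcset[of "{..<k}" "{..<k}" "{..<k}"] by (simp add: injections_def)
  also have "\<dots> = fact k"
    by (simp add: fact_prod_rev)
  finally show ?thesis .
qed

text \<open>On a finite sum of Dirac measures, the expansion in falling powers is a sum over injections,
  so that grouping these by their images makes it a sum over subsets, to be inverted.\<close>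

lemma falling_expansion_inversion:
  fixes x :: "nat \<Rightarrow> 'a::polish_space" and g :: "nat \<Rightarrow> (nat \<Rightarrow> 'a) \<Rightarrow> 'f::{real_normed_field,euclidean_space}"
  assumes lc: "locally_compact_space (euclidean :: 'a topology)"
    and g: "\<And>m. m \<le> n \<Longrightarrow> g m \<in> test_functions m" and k: "k \<le> n" and x: "x \<in> topspace (power_top k)"
  shows "g k x = (-1) ^ k / fact k *
    (\<Sum>I\<in>Pow {..<k}. (-1) ^ card I * (\<Sum>m\<le>n. pairing m (falling_power (sum_dirac x I) m) (g m)))"
proof -
  define q where "q I = (\<Sum>m\<le>n. pairing m (falling_power (sum_dirac x I) m) (g m))" for I
  define F where "F m s = g m (restrict (x \<circ> s) {..<m})" for m s
  \<comment> \<open>Only injections with image exactly J are counted, a condition independent of the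
    set I containing J. Hence q is the subset sum of h, the form required for the inversion.\<close>
  define h where "h J = (\<Sum>m\<le>n. \<Sum>s | s \<in> injections m J \<and> s ` {..<m} = J. F m s)" for J
  have "q I = sum h (Pow I)" if I: "finite I" for I
  proof -
    have "q I = (\<Sum>m\<le>n. \<Sum>s\<in>injections m I. F m s)"
      unfolding q_def F_def using g
      by (intro sum.cong refl pairing_falling_sum_dirac[OF lc I]) (auto simp: test_functions_iff)
    also have "\<dots> = (\<Sum>m\<le>n. \<Sum>J\<in>Pow I. \<Sum>s | s \<in> injections m I \<and> s ` {..<m} = J. F m s)"
      using I by (intro sum.cong refl sum.group[symmetric] finite_injections) (auto simp: injections_def)
    also have "\<dots> = (\<Sum>m\<le>n. \<Sum>J\<in>Pow I. \<Sum>s | s \<in> injections m J \<and> s ` {..<m} = J. F m s)"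
      by (intro sum.cong refl) (auto simp: injections_def PiE_def Pi_def)
    also have "\<dots> = sum h (Pow I)"
      unfolding h_def by (rule sum.swap)
    finally show ?thesis .
  qed
  then have inv: "h {..<k} = (\<Sum>I\<in>Pow {..<k}. (-1) ^ (k - card I) * q I)"
    using inclusion_exclusion_mobius[of q h "{..<k}"] by simp
  have "h {..<k} = (\<Sum>s\<in>injections k {..<k}. F k s)"
  proof -
    have "(\<Sum>s | s \<in> injections m {..<k} \<and> s ` {..<m} = {..<k}. F m s) =
        (if m = k then \<Sum>s\<in>injections k {..<k}. F k s else 0)" for m
    proof (cases "m = k")
      case True
      then show ?thesis by (simp add: surjective_injections)
    next
      case False
      have empty: "{s \<in> injections m {..<k}. s ` {..<m} = {..<k}} = {}"
      proof -
        have "m = k" if "inj_on s {..<m}" "s ` {..<m} = {..<k}" for s :: "nat \<Rightarrow> nat"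
          using card_image[OF that(1)] that(2) by simp
        then show ?thesis
          using False by (auto simp: injections_def)
      qed
      show ?thesis
        unfolding empty using False by simp
    qed
    then show ?thesis
      using k by (simp add: h_def)
  qed
  also have "\<dots> = (\<Sum>s\<in>injections k {..<k}. g k x)"
  proof (rule sum.cong[OF refl])
    fix s :: "nat \<Rightarrow> nat" assume s: "s \<in> injections k {..<k}"
    \<comment> \<open>Members of \<open>injections\<close> are \<open>undefined\<close> off {..<k},
      whereas \<open>permutes\<close> demands the identity there.\<close>
    define \<pi> where "\<pi> i = (if i < k then s i else i)" for i
    have "s ` {..<k} = {..<k}"
      using s surjective_injections[of k] by auto
    then have "bij_betw \<pi> {..<k} {..<k}"
      using s by (auto simp: bij_betw_def \<pi>_def injections_def inj_on_def)
    then have \<pi>: "\<pi> permutes {..<k}"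
      by (rule bij_imp_permutes) (simp add: \<pi>_def)
    have "restrict (x \<circ> s) {..<k} = x \<circ> \<pi>"
      using x by (auto simp: fun_eq_iff \<pi>_def PiE_def extensional_def)
    then show "F k s = g k x"
      using g[OF k] \<pi> x by (simp add: F_def test_functions_iff)
  qed
  also have "\<dots> = fact k * g k x"
    by (simp add: card_injections)
  finally have "fact k * g k x = (\<Sum>I\<in>Pow {..<k}. (-1) ^ (k - card I) * q I)"
    using inv by simp
  also have "\<dots> = (\<Sum>I\<in>Pow {..<k}. (-1) ^ k * ((-1) ^ card I * q I))"
  proof (rule sum.cong[OF refl])
    fix I assume "I \<in> Pow {..<k}"
    then have "card I \<le> k"
      using card_mono[of "{..<k}" I] by simp
    then show "(-1) ^ (k - card I) * q I = (-1) ^ k * ((-1) ^ card I * q I)"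
      by (simp add: neg_one_power_add_eq_neg_one_power_diff[symmetric] power_add)
  qed
  finally have "fact k * g k x = (-1) ^ k * (\<Sum>I\<in>Pow {..<k}. (-1) ^ card I * q I)"
    by (simp add: sum_distrib_left)
  then show ?thesis
    unfolding q_def by (simp add: field_simps)
qed

text \<open>The innermost operator \<open>diff_op (x k)\<close> is split off and acts on p, so p
  varies in the induction while \<omega> stays fixed. The subsets of {..<Suc k} are sorted by
  whether they contain k; those that do carry the opposite sign and the additional Dirac
  mass.\<close>

lemma diff_op_iterate:
  "foldr (\<lambda>i. diff_op (x i)) [0..<k] p \<omega> =
    (-1) ^ k * (\<Sum>I\<in>Pow {..<k}. (-1) ^ card I * p (\<lambda>A. \<omega> A + sum_dirac x I A))"
proof (induction k arbitrary: p)
  case 0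
  then show ?case by (simp add: sum_dirac_def)
next
  case (Suc k)
  let ?S = "\<lambda>I A. \<omega> A + sum_dirac x I A"
  have Pow: "Pow {..<Suc k} = Pow {..<k} \<union> insert k ` Pow {..<k}"
    by (simp add: lessThan_Suc Pow_insert)
  have inj: "inj_on (insert k) (Pow {..<k})"
    by (auto simp: inj_on_def)
  have "(\<Sum>I\<in>insert k ` Pow {..<k}. (-1) ^ card I * p (?S I)) =
      (\<Sum>I\<in>Pow {..<k}. - ((-1) ^ card I * p (\<lambda>A. ?S I A + dirac euclidean (x k) A)))"
    unfolding sum.reindex[OF inj] comp_def
  proof (rule sum.cong[OF refl])
    fix I assume I: "I \<in> Pow {..<k}"
    then have "finite I" "k \<notin> I"
      using finite_subset by auto
    then show "(-1) ^ card (insert k I) * p (?S (insert k I)) =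
        - ((-1) ^ card I * p (\<lambda>A. ?S I A + dirac euclidean (x k) A))"
      by (simp add: sum_dirac_def add_ac)
  qed
  then have 1: "(\<Sum>I\<in>Pow {..<Suc k}. (-1) ^ card I * p (?S I)) =
     (\<Sum>I\<in>Pow {..<k}. (-1) ^ card I * p (?S I)) -
     (\<Sum>I\<in>Pow {..<k}. (-1) ^ card I * p (\<lambda>A. ?S I A + dirac euclidean (x k) A))"
    unfolding Pow by (subst sum.union_disjoint) (auto simp: sum_negf)
  have 2: "(\<Sum>I\<in>Pow {..<k}. (-1) ^ card I * diff_op (x k) p (?S I)) =
      (\<Sum>I\<in>Pow {..<k}. (-1) ^ card I * p (\<lambda>A. ?S I A + dirac euclidean (x k) A)) -
      (\<Sum>I\<in>Pow {..<k}. (-1) ^ card I * p (?S I))"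
    by (simp add: diff_op_def right_diff_distrib sum_subtractf)
  have "foldr (\<lambda>i. diff_op (x i)) [0..<Suc k] p \<omega> = foldr (\<lambda>i. diff_op (x i)) [0..<k] (diff_op (x k) p) \<omega>"
    by simp
  then show ?case
    unfolding 1 Suc.IH 2 by (simp add: algebra_simps)
qed

section \<open>Existence and uniqueness of the Stirling operators\<close>

lemma stirling_family_stirling:
  assumes lc: "locally_compact_space (euclidean :: 'a::polish_space topology)" and n: "n \<ge> 1"
  shows "stirling_family n (stirling n :: nat \<Rightarrow> ((nat \<Rightarrow> 'a) \<Rightarrow> 'f::{real_normed_field,euclidean_space}) \<Rightarrow> _)"
  unfolding stirling_family_def linear_on_test_functions_def
proof (intro conjI ballI allI)
  fix \<omega> :: "'a set \<Rightarrow> 'f" and f :: "(nat \<Rightarrow> 'a) \<Rightarrow> 'f"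
  assume \<omega>: "\<omega> \<in> radon_measures euclidean" and f: "f \<in> test_functions n"
  have "pairing n (tensor_power \<omega> n) f = (\<Sum>k\<le>n. pairing k (falling_power \<omega> k) (stirling n k f))"
    using f by (intro pairing_tensor_power_stirling[OF lc \<omega>]) (auto simp: test_functions_iff)
  also have "{..n} = insert 0 {1..n}"
    by auto
  finally show "pairing n (tensor_power \<omega> n) f = (\<Sum>k=1..n. pairing k (falling_power \<omega> k) (stirling n k f))"
    by (simp add: stirling_0[OF n] pairing_falling_zero[OF lc \<omega>] del: falling_power.simps)
qed (simp_all add: stirling_test_functions stirling_add stirling_mult_left)

text \<open>Stated for an arbitrary family so that it serves twice: for the explicit operators it is
  the claimed formula, and for two families it forces agreement, since the right-hand side does not
  mention S.\<close>

lemma stirling_family_formula: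
  fixes S :: "nat \<Rightarrow> ((nat \<Rightarrow> 'a::polish_space) \<Rightarrow> 'f::{real_normed_field,euclidean_space}) \<Rightarrow> (nat \<Rightarrow> 'a) \<Rightarrow> 'f"
  assumes lc: "locally_compact_space (euclidean :: 'a topology)" and S: "stirling_family n S"
    and k: "k \<in> {1..n}" and f: "f \<in> test_functions n" and x: "x \<in> topspace (power_top k)"
  shows "S k f x = (-1) ^ k / fact k *
    (\<Sum>I\<in>Pow {..<k}. (-1) ^ card I * pairing n (tensor_power (sum_dirac x I) n) f)"
proof -
  \<comment> \<open>The family is only constrained for indices from 1 to n. The value 0 at index 0
    completes its defining relation to an expansion starting at 0, as the inversion expects.\<close>
  define g where "g m = (if m = 0 then (\<lambda>_. 0) else S m f)" for m
  have "(\<lambda>_. 0) \<in> (test_functions 0 :: ((nat \<Rightarrow> 'a) \<Rightarrow> 'f) set)"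
    by (simp add: test_functions_iff bounded_cs_zero)
  then have g: "g m \<in> test_functions m" if "m \<le> n" for m
    using S f that unfolding stirling_family_def linear_on_test_functions_def g_def by auto
  have "(\<Sum>m\<le>n. pairing m (falling_power (sum_dirac x I) m) (g m)) = pairing n (tensor_power (sum_dirac x I) n) f"
    if "I \<in> Pow {..<k}" for I
  proof -
    have \<omega>: "(sum_dirac x I :: 'a set \<Rightarrow> 'f) \<in> radon_measures euclidean"
      using that finite_subset by (intro sum_dirac_radon) auto
    have "{..n} = insert 0 {1..n}"
      by auto
    then have "(\<Sum>m\<le>n. pairing m (falling_power (sum_dirac x I) m) (g m)) =
        (\<Sum>m=1..n. pairing m (falling_power (sum_dirac x I) m) (S m f))"
      by (simp add: g_def pairing_falling_zero[OF lc \<omega>] del: falling_power.simps)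
    also have "\<dots> = pairing n (tensor_power (sum_dirac x I) n) f"
      using S \<omega> f unfolding stirling_family_def by metis
    finally show ?thesis .
  qed
  then have "(\<Sum>I\<in>Pow {..<k}. (-1) ^ card I * (\<Sum>m\<le>n. pairing m (falling_power (sum_dirac x I) m) (g m))) =
      (\<Sum>I\<in>Pow {..<k}. (-1) ^ card I * pairing n (tensor_power (sum_dirac x I) n) f)"
    by (intro sum.cong refl arg_cong2[where f="(*)"])
  moreover have "S k f x = g k x" "k \<le> n"
    using k by (simp_all add: g_def)
  ultimately show ?thesis
    using falling_expansion_inversion[of n g k x, OF lc g _ x] by (simp only:)
qed

text \<open>Any two families obey the same formula on the points of the k-th power, and test
  functions vanish elsewhere. They hence agree as functions, which the uniqueness part of the
  definite description demands.\<close>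

lemma stirling_op_eq:
  fixes f :: "(nat \<Rightarrow> 'a::polish_space) \<Rightarrow> 'f::{real_normed_field,euclidean_space}"
  assumes lc: "locally_compact_space (euclidean :: 'a topology)" and k: "k \<in> {1..n}" and f: "f \<in> test_functions n"
  shows "stirling_op n k f = stirling n k f"
  unfolding stirling_op_def
proof (rule the_equality)
  have fam: "stirling_family n (stirling n :: nat \<Rightarrow> ((nat \<Rightarrow> 'a) \<Rightarrow> 'f) \<Rightarrow> _)"
    using k by (intro stirling_family_stirling[OF lc]) auto
  then show "\<exists>S. stirling_family n S \<and> S k f = stirling n k f"
    by blast
  fix g assume "\<exists>S. stirling_family n S \<and> S k f = g"
  then obtain S where S: "stirling_family n S" "S k f = g"
    by blast
  have "S k f \<in> test_functions k" "stirling n k f \<in> test_functions k"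
    using S(1) fam k f unfolding stirling_family_def linear_on_test_functions_def by blast+
  then have bcs: "bounded_cs (power_top k) (S k f)" "bounded_cs (power_top k) (stirling n k f)"
    by (simp_all add: test_functions_iff)
  have "S k f x = stirling n k f x" for x
  proof (cases "x \<in> topspace (power_top k)")
    case True
    then show ?thesis
      by (simp only: stirling_family_formula[OF lc S(1) k f] stirling_family_formula[OF lc fam k f])
  next
    case False
    show ?thesis
      using bounded_cs_power_outside[OF bcs(1) False] bounded_cs_power_outside[OF bcs(2) False] by simp
  qed
  then show "g = stirling n k f"
    using S(2) by auto
qed

theorem theorem4p1:
  assumes "locally_compact_space (euclidean :: 'a::polish_space topology)"
  shows
    "(\<forall>n (p :: ('a set \<Rightarrow> 'f::{real_normed_field,euclidean_space}) \<Rightarrow> 'f).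
        polynomial_of_degree n p \<longrightarrow>
        (\<exists>g. (\<forall>k\<le>n. g k \<in> test_functions k) \<and>
             g 0 (\<lambda>_. undefined) = p zero_measure \<and>
             (\<forall>k\<in>{1..n}. \<forall>x\<in>topspace (power_top k).
                g k x = 1 / fact k * foldr (\<lambda>i. diff_op (x i)) [0..<k] p zero_measure \<and>
                g k x = (-1) ^ k / fact k *
                          (\<Sum>I\<in>Pow {..<k}. (-1) ^ card I * p (sum_dirac x I))) \<and>
             (\<forall>\<omega>\<in>radon_measures euclidean.
                p \<omega> = (\<Sum>k\<le>n. pairing k (falling_power \<omega> k) (g k))))) \<and>
     (\<forall>n. \<forall>k\<in>{1..n}. \<forall>f \<in> (test_functions n :: ((nat \<Rightarrow> 'a) \<Rightarrow> 'f) set).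
        \<forall>x\<in>topspace (power_top k).
          stirling_op n k f x = (-1) ^ k / fact k *
            (\<Sum>I\<in>Pow {..<k}. (-1) ^ card I * pairing n (tensor_power (sum_dirac x I) n) f))"
proof (intro conjI allI impI ballI)
  fix n k and f :: "(nat \<Rightarrow> 'a) \<Rightarrow> 'f" and x :: "nat \<Rightarrow> 'a"
  assume k: "k \<in> {1..n}" and f: "f \<in> test_functions n" and x: "x \<in> topspace (power_top k)"
  have "stirling_family n (stirling n :: nat \<Rightarrow> ((nat \<Rightarrow> 'a) \<Rightarrow> 'f) \<Rightarrow> _)"
    using k by (intro stirling_family_stirling[OF assms]) auto
  from stirling_family_formula[OF assms this k f x]
  show "stirling_op n k f x = (-1) ^ k / fact k *
      (\<Sum>I\<in>Pow {..<k}. (-1) ^ card I * pairing n (tensor_power (sum_dirac x I) n) f)"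
    by (simp only: stirling_op_eq[OF assms k f])
next
  fix n and p :: "('a set \<Rightarrow> 'f) \<Rightarrow> 'f"
  assume "polynomial_of_degree n p"
  then obtain f where f: "\<And>k. k \<le> n \<Longrightarrow> f k \<in> test_functions k"
    and p: "\<And>\<omega>. \<omega> \<in> radon_measures euclidean \<Longrightarrow> p \<omega> = (\<Sum>k\<le>n. pairing k (tensor_power \<omega> k) (f k))"
    unfolding polynomial_of_degree_def by blast
  \<comment> \<open>Every coefficient of p contributes to \<open>g k\<close>. Letting m and k both
    run up to n makes the double sum rectangular, so that it can be interchanged.\<close>
  define g where "g k x = (\<Sum>m\<le>n. stirling m k (f m) x)" for k x
  have st: "stirling m k (f m) \<in> test_functions k" if "m \<le> n" for m k
    by (intro stirling_test_functions f that)
  have g: "g k \<in> test_functions k" for k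
    using st unfolding g_def[abs_def] test_functions_iff by (auto intro!: bounded_cs_sum sum.cong)
  have expand: "p \<omega> = (\<Sum>k\<le>n. pairing k (falling_power \<omega> k) (g k))" if \<omega>: "\<omega> \<in> radon_measures euclidean" for \<omega>
  proof -
    have "p \<omega> = (\<Sum>m\<le>n. \<Sum>k\<le>n. pairing k (falling_power \<omega> k) (stirling m k (f m)))"
      unfolding p[OF \<omega>] using f
      by (intro sum.cong refl pairing_tensor_power_stirling[OF assms \<omega>]) (auto simp: test_functions_iff)
    also have "\<dots> = (\<Sum>k\<le>n. \<Sum>m\<le>n. pairing k (falling_power \<omega> k) (stirling m k (f m)))"
      by (rule sum.swap)
    also have "\<dots> = (\<Sum>k\<le>n. pairing k (falling_power \<omega> k) (g k))"
      unfolding g_def[abs_def] using st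
      by (intro sum.cong refl pairing_falling_sum[OF assms \<omega>, symmetric]) (auto simp: test_functions_iff)
    finally show ?thesis .
  qed
  have formula: "g k x = (-1) ^ k / fact k * (\<Sum>I\<in>Pow {..<k}. (-1) ^ card I * p (sum_dirac x I))"
    if k: "k \<le> n" and x: "x \<in> topspace (power_top k)" for k x
  proof -
    have "p (sum_dirac x I) = (\<Sum>m\<le>n. pairing m (falling_power (sum_dirac x I) m) (g m))"
      if "I \<in> Pow {..<k}" for I
      using that finite_subset by (intro expand sum_dirac_radon) auto
    then have "(\<Sum>I\<in>Pow {..<k}. (-1) ^ card I * p (sum_dirac x I)) =
        (\<Sum>I\<in>Pow {..<k}. (-1) ^ card I * (\<Sum>m\<le>n. pairing m (falling_power (sum_dirac x I) m) (g m)))"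
      by (intro sum.cong refl arg_cong2[where f="(*)"])
    then show ?thesis
      using falling_expansion_inversion[of n g k x, OF assms g k x] by (simp only:)
  qed
  show "\<exists>g. (\<forall>k\<le>n. g k \<in> test_functions k) \<and>
             g 0 (\<lambda>_. undefined) = p zero_measure \<and>
             (\<forall>k\<in>{1..n}. \<forall>x\<in>topspace (power_top k).
                g k x = 1 / fact k * foldr (\<lambda>i. diff_op (x i)) [0..<k] p zero_measure \<and>
                g k x = (-1) ^ k / fact k *
                          (\<Sum>I\<in>Pow {..<k}. (-1) ^ card I * p (sum_dirac x I))) \<and>
             (\<forall>\<omega>\<in>radon_measures euclidean.
                p \<omega> = (\<Sum>k\<le>n. pairing k (falling_power \<omega> k) (g k)))"
  proof (intro exI[of _ g] conjI allI impI ballI g expand)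
    \<comment> \<open>For k = 0 the inversion has the empty set as its only index, and the empty sum
      of Dirac measures is the zero measure.\<close>
    show "g 0 (\<lambda>_. undefined) = p zero_measure"
      using formula[of 0 "\<lambda>_. undefined"] by (simp add: sum_dirac_def zero_measure_def)
    fix k and x :: "nat \<Rightarrow> 'a" assume "k \<in> {1..n}" and x: "x \<in> topspace (power_top k)"
    then have k: "k \<le> n" by simp
    show "g k x = (-1) ^ k / fact k * (\<Sum>I\<in>Pow {..<k}. (-1) ^ card I * p (sum_dirac x I))"
      by (rule formula[OF k x])
    then show "g k x = 1 / fact k * foldr (\<lambda>i. diff_op (x i)) [0..<k] p zero_measure"
      unfolding diff_op_iterate by (simp add: zero_measure_def)
  qed
qed

end
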